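(* Let $\mu$ be a probability distribution on $\mathbb{N}$ such that $(\mu(n),n\ge1)$ is regularly varying at infinity with index $-\alpha$ for some $\alpha\ge1$. Let $\bar{\mu}(j)=\mu(\{j,j+1,j+2,\ldots\})$ denote its tail. Then $\mu$ has a well-defined type $d$ given by $$d=\inf\Big\{h\in\mathbb{N}:\ \sum_{j}\bar{\mu}(j)^h<\infty\Big\}$$ (with $\inf\emptyset=\infty$). In particular, $\mu$ is of finite type (i.e. $d<\infty$) if $\alpha>1$ and of infinite type (i.e. $d=\infty$) if $\alpha=1$.
   Context: $\mathbb{N}=\{1,2,\ldots\}$ and $\mathbb{Z}_+=\{0,1,2,\ldots\}$. The set of configurations is $$\mathcal{S}=\Big\{X:\mathbb{Z}\to\mathbb{Z}_+\cup\{\infty\}\ :\ \sup\{j\in\mathbb{Z}: X(j)\neq 0\}\in(-\infty,\infty)\Big\};$$ $X(j)$ is the number of balls in the bin at position $j$ (so a configuration has at least one ball, and bins far enough to the right are empty). For $X\in\mathcal{S}$ and $k\in\mathbb{N}$, let $B(X,k)=\sup\{j\in\mathbb{Z}:\sum_{i=j}^\infty X(i)\ge k\}$ (location of the $k$th rightmost ball), with $\sup\emptyset=-\infty$. For $\xi\in\mathbb{N}$ define $\Phi_\xi:\mathcal{S}\to\mathcal{S}$ by $\Phi_\xi(X)(j)=X(j)+\mathbf{1}_{\{j=B(X,\xi)+1\}}$ for all $j\in\mathbb{Z}$ if $B(X,\xi)>-\infty$, and $\Phi_\xi(X)=X$ otherwise. Given a probability distribution $\mu$ on $\mathbb{N}$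 and $X_0\in\mathcal{S}$ (deterministic), the infinite-bin model (IBM) with reproduction law $\mu$ started from $X_0$ is the process defined by $X_{n+1}=\Phi_{\xi_{n+1}}(X_n)$, $n\ge 0$, where $(\xi_n)_{n\ge1}$ are i.i.d. with law $\mu$. Since $X_n(k)$ is non-decreasing in $n$, the limit $X_\infty(k)=\lim_{n\to\infty}X_n(k)\in\mathbb{Z}_+\cup\{\infty\}$ exists for every $k\in\mathbb{Z}$. $(\widehat{X}_n)_{n\ge0}$ denotes the IBM with reproduction law $\mu$ started from the configuration $\widehat{X}_0$ with $\widehat{X}_0(0)=\infty$ and $\widehat{X}_0(k)=0$ for $k\ne0$. For a deterministic $d\in\mathbb{N}\cup\{\infty\}$, $\mu$ is said to be of type $d$ if $d=\inf\{k\ge1:\widehat{X}_\infty(k)<+\infty\}$ almost surely (with $\inf\emptyset=\infty$). A positive sequence $(\gamma(n))$ is regularly varying (at infinity) with index $\beta\in\mathbb{R}$ if $\lim_{n\to\infty}\gamma(\lfloor un\rfloor)/\gamma(n)=u^{\beta}$ for all $u>0$; in particular, when $(\mu(n),n\ge1)$ is assumed regularly varying, $\mu(n)>0$ for all $n\geq 1$. *)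

theory Defs
  imports "HOL-Probability.Probability"
begin

type_synonym configuration = "int \<Rightarrow> enat"

definition configs :: "configuration set" where
  "configs = {X. (SUP j\<in>{j. X j \<noteq> 0}. ereal (of_int j)) \<in> {-\<infinity><..<\<infinity>}}"

text \<open>The position of the k-th rightmost ball lives in the extended reals, so that
  the supremum of the empty set is \<open>-\<infinity>\<close>.\<close>

definition ball_pos :: "configuration \<Rightarrow> nat \<Rightarrow> ereal" where
  "ball_pos X k = (SUP j\<in>{j. (\<Sum>\<^sub>\<infinity>i\<in>{j..}. X i) \<ge> enat k}. ereal (of_int j))"

definition move :: "nat \<Rightarrow> configuration \<Rightarrow> configuration" where
  "move k X =
     (if ball_pos X k > -\<infinity>
      then (\<lambda>j. X j + (if ereal (of_int j) = ball_pos X k + 1 then 1 else 0))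
      else X)"

text \<open>The driving sequence is indexed from 1; its value at 0 is never used.\<close>

primrec ibm :: "configuration \<Rightarrow> (nat \<Rightarrow> nat) \<Rightarrow> nat \<Rightarrow> configuration" where
  "ibm X0 \<xi> 0 = X0"
| "ibm X0 \<xi> (Suc n) = move (\<xi> (Suc n)) (ibm X0 \<xi> n)"

definition ibm_limit :: "configuration \<Rightarrow> (nat \<Rightarrow> nat) \<Rightarrow> configuration" where
  "ibm_limit X0 \<xi> k = lim (\<lambda>n. ibm X0 \<xi> n k)"

definition hat_config :: configuration where
  "hat_config k = (if k = 0 then \<infinity> else 0)"

definition front :: "(nat \<Rightarrow> nat) \<Rightarrow> enat" where
  "front \<xi> = (INF k\<in>{k. 1 \<le> k \<and> ibm_limit hat_config \<xi> (int k) < \<infinity>}. enat k)"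

text \<open>The i.i.d. sequence with law \<open>\<mu>\<close> is realised on the canonical product space;
  by \<open>has_type_iff_iid\<close> below, any other realisation gives the same notion.\<close>

definition has_type :: "nat pmf \<Rightarrow> enat \<Rightarrow> bool" where
  "has_type \<mu> d \<longleftrightarrow> (AE \<xi> in PiM {1..} (\<lambda>_. measure_pmf \<mu>). front \<xi> = d)"

definition finite_type :: "nat pmf \<Rightarrow> bool" where
  "finite_type \<mu> \<longleftrightarrow> (\<exists>d. has_type \<mu> d \<and> d < \<infinity>)"

definition infinite_type :: "nat pmf \<Rightarrow> bool" where
  "infinite_type \<mu> \<longleftrightarrow> has_type \<mu> \<infinity>"

text \<open>Only the values at positive integers matter: \<open>\<lfloor>u n\<rfloor>\<close> is positive
  for all large \<open>n\<close>.\<close>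

definition regularly_varying :: "(nat \<Rightarrow> real) \<Rightarrow> real \<Rightarrow> bool" where
  "regularly_varying \<gamma> \<beta> \<longleftrightarrow>
     (\<forall>n\<ge>1. \<gamma> n > 0) \<and>
     (\<forall>u>0. (\<lambda>n. \<gamma> (nat \<lfloor>u * real n\<rfloor>) / \<gamma> n) \<longlonglongrightarrow> u powr \<beta>)"

definition tail :: "nat pmf \<Rightarrow> nat \<Rightarrow> real" where
  "tail \<mu> j = measure_pmf.prob \<mu> {j..}"

lemma hat_config_in_configs: "hat_config \<in> configs"
proof -
  have "{j. hat_config j \<noteq> 0} = {0}" by (auto simp: hat_config_def)
  then show ?thesis by (simp add: configs_def)
qed

lemma ibm_mono: "incseq (\<lambda>n. ibm X0 \<xi> n k)"
  by (rule incseq_SucI) (simp add: move_def)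

lemma ibm_limit_LIMSEQ: "(\<lambda>n. ibm X0 \<xi> n k) \<longlonglongrightarrow> ibm_limit X0 \<xi> k"
proof -
  have L: "(\<lambda>n. ibm X0 \<xi> n k) \<longlonglongrightarrow> (SUP n. ibm X0 \<xi> n k)"
    by (rule LIMSEQ_SUP) (rule ibm_mono)
  show ?thesis unfolding ibm_limit_def limI[OF L] by (rule L)
qed

lemma ibm_cong: "(\<And>n. n \<ge> 1 \<Longrightarrow> \<xi> n = \<xi>' n) \<Longrightarrow> ibm X0 \<xi> n = ibm X0 \<xi>' n"
  by (induction n) auto

lemma front_cong:
  assumes "\<And>n. n \<ge> 1 \<Longrightarrow> \<xi> n = \<xi>' n"
  shows "front \<xi> = front \<xi>'"
proof -
  have "ibm X0 \<xi> n = ibm X0 \<xi>' n" for X0 n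
    using assms by (rule ibm_cong)
  then show ?thesis by (simp add: front_def ibm_limit_def)
qed

lemma measurable_ibm:
  "(\<lambda>\<xi>. ibm X0 \<xi> n) \<in> measurable (PiM {1..} (\<lambda>_. measure_pmf \<mu>)) (count_space UNIV)"
proof (induction n)
  case (Suc n)
  have "(\<lambda>\<xi>. \<xi> (Suc n)) \<in> measurable (PiM {1..} (\<lambda>_. measure_pmf \<mu>)) (measure_pmf \<mu>)"
    by (rule measurable_component_singleton) simp
  then have "(\<lambda>\<xi>. \<xi> (Suc n)) \<in> measurable (PiM {1..} (\<lambda>_. measure_pmf \<mu>)) (count_space UNIV)"
    by simp
  moreover have "(\<lambda>\<xi>. move i (ibm X0 \<xi> n)) \<in>
      measurable (PiM {1..} (\<lambda>_. measure_pmf \<mu>)) (count_space UNIV)" for i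
    using Suc by (rule measurable_compose) simp
  ultimately show ?case
    using measurable_compose_countable[where f = "\<lambda>i \<xi>. move i (ibm X0 \<xi> n)"
        and g = "\<lambda>\<xi>. \<xi> (Suc n)"] by simp
qed simp

lemma ibm_limit_finite_iff:
  "ibm_limit X0 \<xi> k < \<infinity> \<longleftrightarrow> (\<exists>m::nat. \<forall>n. ibm X0 \<xi> n k \<le> enat m)"
proof
  assume "ibm_limit X0 \<xi> k < \<infinity>"
  then obtain m where m: "ibm_limit X0 \<xi> k = enat m" by auto
  have "ibm X0 \<xi> n k \<le> enat m" for n
    unfolding m[symmetric] by (rule incseq_le[OF ibm_mono ibm_limit_LIMSEQ])
  then show "\<exists>m. \<forall>n. ibm X0 \<xi> n k \<le> enat m" by blast
next
  assume "\<exists>m::nat. \<forall>n. ibm X0 \<xi> n k \<le> enat m"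
  then obtain m :: nat where "\<forall>n. ibm X0 \<xi> n k \<le> enat m" by blast
  then have "ibm_limit X0 \<xi> k \<le> enat m"
    by (intro LIMSEQ_le_const2[OF ibm_limit_LIMSEQ]) blast
  then show "ibm_limit X0 \<xi> k < \<infinity>"
    by (rule le_less_trans) simp
qed

lemma measurable_ibm_limit [measurable]:
  "Measurable.pred (PiM {1..} (\<lambda>_. measure_pmf \<mu>)) (\<lambda>\<xi>. ibm_limit X0 \<xi> k < \<infinity>)"
proof -
  have [measurable]: "Measurable.pred (PiM {1..} (\<lambda>_. measure_pmf \<mu>))
      (\<lambda>\<xi>. ibm X0 \<xi> n k \<le> enat m)" for n m
    using measurable_ibm by (rule measurable_compose) simp
  show ?thesis unfolding ibm_limit_finite_iff by measurable
qed

lemma front_eq_iff: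
  "front \<xi> = d \<longleftrightarrow>
     (\<forall>k\<ge>1. ibm_limit hat_config \<xi> (int k) < \<infinity> \<longrightarrow> d \<le> enat k) \<and>
     (d = \<infinity> \<or> (\<exists>k\<ge>1. ibm_limit hat_config \<xi> (int k) < \<infinity> \<and> d = enat k))"
  (is "_ \<longleftrightarrow> ?R")
proof
  define A where "A = enat ` {k. 1 \<le> k \<and> ibm_limit hat_config \<xi> (int k) < \<infinity>}"
  have f: "front \<xi> = Inf A" by (simp add: front_def A_def)
  show ?R if "front \<xi> = d"
  proof (cases "A = {}")
    case True
    then show ?thesis using that f by (auto simp: A_def Inf_enat_def)
  next
    case False
    then obtain a where "a \<in> A" by blast
    then have "Inf A \<in> A" by (rule wellorder_InfI)
    moreover have "\<forall>x\<in>A. Inf A \<le> x" by (auto intro: Inf_lower)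
    ultimately show ?thesis using that f by (auto simp: A_def)
  qed
  show "front \<xi> = d" if r: ?R
  proof -
    have "d \<le> Inf A" using r by (intro Inf_greatest) (auto simp: A_def)
    moreover have "Inf A \<le> d" using r by (auto simp: A_def intro: Inf_lower)
    ultimately show ?thesis using f by simp
  qed
qed

lemma has_type_iff_iid:
  assumes "prob_space M"
    and "prob_space.indep_vars M (\<lambda>_. count_space UNIV) \<xi> {1..}"
    and "\<And>n. n \<ge> 1 \<Longrightarrow> distr M (count_space UNIV) (\<xi> n) = measure_pmf \<mu>"
  shows "has_type \<mu> d \<longleftrightarrow> (AE \<omega> in M. front (\<lambda>n. \<xi> n \<omega>) = d)"
proof -
  interpret prob_space M by fact
  let ?C = "\<lambda>_::nat. count_space (UNIV :: nat set)"
  let ?P = "PiM {1..} (\<lambda>_::nat. measure_pmf \<mu>)"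
  let ?f = "\<lambda>\<omega>. \<lambda>n\<in>{1..}. \<xi> n \<omega>"
  have rv: "\<xi> n \<in> measurable M (count_space UNIV)" if "n \<ge> 1" for n
    using assms(2) that by (auto simp: indep_vars_def)
  have "distr M (PiM {1..} ?C) ?f = PiM {1..} (\<lambda>n. distr M (count_space UNIV) (\<xi> n))"
    using indep_vars_iff_distr_eq_PiM'[of "{1..}" \<xi> ?C] rv assms(2) by auto
  also have "\<dots> = ?P" using assms(3) by (intro PiM_cong) auto
  finally have d: "distr M (PiM {1..} ?C) ?f = ?P" .
  have s: "sets (PiM {1..} ?C) = sets ?P" by (intro sets_PiM_cong) auto
  have m: "Measurable.pred ?P (\<lambda>\<xi>. front \<xi> = d)"
    unfolding front_eq_iff by measurable
  have fm: "?f \<in> measurable M (PiM {1..} ?C)"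
    using rv by (intro measurable_restrict) auto
  have "has_type \<mu> d \<longleftrightarrow> (AE \<zeta> in distr M (PiM {1..} ?C) ?f. front \<zeta> = d)"
    by (simp only: has_type_def d)
  also have "\<dots> \<longleftrightarrow> (AE \<omega> in M. front (?f \<omega>) = d)"
  proof (rule AE_distr_iff[OF fm])
    show "{x \<in> space (PiM {1..} ?C). front x = d} \<in> sets (PiM {1..} ?C)"
      using m s sets_eq_imp_space_eq[OF s] by (simp add: pred_def)
  qed
  also have "\<dots> \<longleftrightarrow> (AE \<omega> in M. front (\<lambda>n. \<xi> n \<omega>) = d)"
  proof -
    have "front (?f \<omega>) = front (\<lambda>n. \<xi> n \<omega>)" for \<omega>
      by (rule front_cong) simp
    then show ?thesis by simp
  qed
  finally show ?thesis .
qed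

end

theory Submission
  imports Defs "HOL-Real_Asymp.Real_Asymp"
begin

text \<open>In the model started from infinitely many balls at \<open>0\<close>, let \<open>S k n\<close> be the number of balls at
positions \<open>\<ge> k\<close> after \<open>n\<close> steps. Every step puts one ball to the right of
\<open>0\<close>, so \<open>S 1 n = n\<close>, and the new ball lands at a position \<open>\<ge> k + 1\<close> exactly
if \<open>\<xi> (n + 1) \<le> S k n\<close>. So bin \<open>k\<close> receives the ball of step \<open>n + 1\<close>
exactly if \<open>S k n < \<xi> (n + 1) \<le> S (k - 1) n\<close> (for \<open>k = 1\<close>: if
\<open>n < \<xi> (n + 1)\<close>). Every occurrence of \<open>\<xi> = 1\<close> moves the front by one bin, and
therefore \<open>S k n\<close>, which is at most \<open>n\<close>, is almost surely at least \<open>\<delta> n\<close>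
for large \<open>n\<close> (\<open>AE_balls_linear\<close>). Regular variation makes \<open>\<mu> j\<close> comparable
to \<open>\<mu> n\<close> for all \<open>j\<close> between \<open>\<delta> n\<close> and \<open>n\<close>
(\<open>regularly_varying_comparable\<close>), and the conditional probability that bin \<open>k + 1\<close> is hit at
time \<open>n + 1\<close> is thus comparable to \<open>X k n * \<mu> n\<close>, where
\<open>X k n = S k n - S (k + 1) n\<close> is the current content of bin \<open>k\<close>
(\<open>prob_fill_comparable\<close>). Bin 1 is hit with probability \<open>tail \<mu> (n + 1)\<close>.

Infinite bins (\<open>AE_fill_rate_ge\<close>, \<open>AE_bin_infinite\<close>): write \<open>g n = n * \<mu> n\<close>,
which is at most a constant times the tail. If \<open>\<Sum>n. g n ^ h\<close> diverges, then by induction on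
\<open>k \<le> h\<close> the hitting rate of bin \<open>k\<close> is eventually at least \<open>c * g n ^ k\<close>. For
\<open>k < h\<close> the expected number of hits between \<open>n / 2\<close> and \<open>n\<close> is then at least of
order \<open>n * g n ^ k\<close>, which exceeds a positive power of \<open>n\<close>; an exponential bound on the
probability of few hits (\<open>few_hits_bound\<close>) gives \<open>X k n \<ge> c * n * g n ^ k\<close> eventually, and
so the rate of bin \<open>k + 1\<close> is at least \<open>c * g n ^ (k + 1)\<close>. At \<open>k = h\<close> the rates
have a divergent sum and bin \<open>h\<close> is hit infinitely often.

Finite bins (\<open>AE_bin_finite\<close>): as long as the bound \<open>S k n \<ge> \<delta> n\<close> holds, the
probabilities \<open>a k n\<close> that bin \<open>k\<close> is hit at time \<open>n + 1\<close> satisfy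
\<open>a 1 n \<le> tail \<mu> n\<close> and \<open>a (k + 1) n \<le> C * \<mu> n * (N + (\<Sum>m<n. a k m))\<close>.
Exchanging the sums over \<open>n\<close> and \<open>m\<close> turns \<open>\<Sum>n>m. \<mu> n\<close> into another
factor \<open>tail \<mu> m\<close>, so that \<open>\<Sum>n. a k n * tail \<mu> n ^ (h - k)\<close> is finite for all
\<open>k \<le> h\<close> once \<open>\<Sum>n. tail \<mu> n ^ h\<close> is finite. For \<open>k = h\<close> this bounds
the expected number of hits of bin \<open>h\<close>, which therefore stays finite.

It remains to compare \<open>g\<close> with the tail (\<open>summable_tail_power_iff\<close>). For
\<open>\<alpha> > 1\<close> they are comparable. For \<open>\<alpha> = 1\<close> both \<open>\<Sum>n. g n ^ h\<close>
and \<open>\<Sum>n. tail \<mu> n ^ h\<close> diverge for every \<open>h\<close>, because \<open>g\<close> decays more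
slowly than any negative power of \<open>n\<close>.\<close>

section \<open>Regularly varying sequences\<close>

definition comparable :: "real \<Rightarrow> real \<Rightarrow> real \<Rightarrow> bool" where
  "comparable C x y \<longleftrightarrow> x \<le> C * y \<and> y \<le> C * x"

lemma comparable_trans:
  assumes "comparable C x y" "comparable D y z" "0 \<le> C" "0 \<le> D"
  shows "comparable (C * D) x z"
proof -
  have "x \<le> C * (D * z)" using assms unfolding comparable_def
    by (meson mult_left_mono order_trans)
  moreover have "z \<le> D * (C * x)" using assms unfolding comparable_def
    by (meson mult_left_mono order_trans)
  ultimately show ?thesis by (simp add: comparable_def mult_ac)
qed

lemma comparable_mono:
  assumes "comparable C x y" "C \<le> D" "0 \<le> x" "0 \<le> y"
  shows "comparable D x y"
  using assms unfolding comparable_def by (meson mult_right_mono order_trans)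

lemma comparable_sym: "comparable C x y \<longleftrightarrow> comparable C y x"
  by (auto simp: comparable_def)

lemma comparable_LIMSEQ:
  fixes f g :: "nat \<Rightarrow> real"
  assumes lim: "(\<lambda>n. f n / g n) \<longlonglongrightarrow> L" and L: "1 / C < L" "L < C" and C: "0 < C"
    and g: "\<And>n. n \<ge> 1 \<Longrightarrow> g n > 0"
  shows "\<forall>\<^sub>F n in sequentially. comparable C (f n) (g n)"
proof -
  have "\<forall>\<^sub>F n in sequentially. 1 / C < f n / g n" using lim L(1) by (rule order_tendstoD)
  moreover have "\<forall>\<^sub>F n in sequentially. f n / g n < C" using lim L(2) by (rule order_tendstoD)
  moreover have "\<forall>\<^sub>F n::nat in sequentially. n \<ge> 1" by (rule eventually_ge_at_top)
  ultimately show ?thesis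
  proof eventually_elim
    case (elim n)
    with g[of n] C show ?case by (auto simp: comparable_def field_simps)
  qed
qed

text \<open>The limits that define regular variation are only pointwise in \<open>u\<close>; a Baire category argument makes them
uniform on some small interval. The points of \<open>[1, 2]\<close> at which the ratio leaves the interval
\<open>[1 / C, C]\<close> at some time \<open>n \<ge> N\<close> cannot form, for every \<open>N\<close>, a set with
dense interior, since a point common to all these interiors would contradict convergence. Passing to interiors costs
nothing: \<open>\<lfloor>u * n\<rfloor>\<close> is constant on a small interval to the right of \<open>u\<close>, so a
bad point is followed by a whole interval of bad points.\<close>

lemma regularly_varying_comparable_on_interval:
  assumes rv: "regularly_varying \<gamma> \<rho>"
  obtains C a b N where "1 \<le> C" "1 \<le> a" "a < b"
    "\<And>u n. a < u \<Longrightarrow> u < b \<Longrightarrow> N \<le> n \<Longrightarrow> comparable C (\<gamma> (nat \<lfloor>u * real n\<rfloor>)) (\<gamma> n)"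
proof -
  have pos: "\<gamma> n > 0" if "n \<ge> 1" for n using rv that by (auto simp: regularly_varying_def)
  define C where "C = 2 powr \<bar>\<rho>\<bar> + 1"
  have C1: "1 \<le> C" by (simp add: C_def)
  have ev: "\<forall>\<^sub>F n in sequentially. comparable C (\<gamma> (nat \<lfloor>u * real n\<rfloor>)) (\<gamma> n)"
    if u: "u \<in> {1..2}" for u :: real
  proof (rule comparable_LIMSEQ)
    show "(\<lambda>n. \<gamma> (nat \<lfloor>u * real n\<rfloor>) / \<gamma> n) \<longlonglongrightarrow> u powr \<rho>"
      using rv u by (auto simp: regularly_varying_def)
    have "u powr \<rho> \<le> u powr \<bar>\<rho>\<bar>" using u by (intro powr_mono) auto
    also have "\<dots> \<le> 2 powr \<bar>\<rho>\<bar>" using u by (intro powr_mono2) auto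
    finally show "u powr \<rho> < C" by (simp add: C_def)
    have "u powr (-\<rho>) \<le> u powr \<bar>\<rho>\<bar>" using u by (intro powr_mono) auto
    also have "\<dots> \<le> 2 powr \<bar>\<rho>\<bar>" using u by (intro powr_mono2) auto
    finally have "u powr (-\<rho>) < C" by (simp add: C_def)
    then show "1 / C < u powr \<rho>" using C1 u
      by (simp add: powr_minus field_simps)
    show "0 < C" using C1 by simp
  qed (rule pos)
  define bad where "bad N = {u. \<exists>n\<ge>N. \<not> comparable C (\<gamma> (nat \<lfloor>u * real n\<rfloor>)) (\<gamma> n)}" for N
  define G where "G = range (\<lambda>N. {1..2::real} \<inter> interior (bad N))"
  have "\<exists>N. \<not> {1..2} \<subseteq> closure ({1..2} \<inter> interior (bad N))"
  proof (rule ccontr)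
    assume "\<not> ?thesis"
    then have "\<And>T. T \<in> G \<Longrightarrow> openin (top_of_set {1..2}) T \<and> {1..2} \<subseteq> closure T"
      by (auto simp: G_def openin_open_Int)
    then have "{1..2::real} \<subseteq> closure (\<Inter>G)"
      by (intro Baire) (auto simp: G_def)
    then have "\<Inter>G \<noteq> {}" by auto
    then obtain u where u: "u \<in> \<Inter>G" by blast
    then have "u \<in> {1..2}" "\<And>N. u \<in> bad N"
      using interior_subset by (auto simp: G_def)
    with ev[of u] show False by (fastforce simp: bad_def eventually_sequentially)
  qed
  then obtain N u0 where u0: "u0 \<in> {1..2}" "u0 \<notin> closure ({1..2} \<inter> interior (bad N))" by blast
  then obtain e where e: "e > 0" "\<And>v. v \<in> {1..2} \<Longrightarrow> v \<in> interior (bad N) \<Longrightarrow> e \<le> dist v u0"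
    by (auto simp: closure_approachable not_less)
  define a b where "a = max 1 (u0 - e)" and "b = min 2 (u0 + e)"
  have ab: "1 \<le> a" "a < b" using u0(1) e(1) by (auto simp: a_def b_def)
  have nbad: "v \<notin> interior (bad N)" if "a < v" "v < b" for v
    using e(2)[of v] that by (auto simp: a_def b_def dist_real_def)
  show ?thesis
  proof (rule that[OF C1 ab])
    fix u n assume u: "a < u" "u < b" and n: "Suc N \<le> n"
    show "comparable C (\<gamma> (nat \<lfloor>u * real n\<rfloor>)) (\<gamma> n)"
    proof (rule ccontr)
      assume nc: "\<not> ?thesis"
      define u' where "u' = (real_of_int \<lfloor>u * real n\<rfloor> + 1) / real n"
      have n0: "real n > 0" using n by simp
      have uu': "u < u'" using n0 by (simp add: u'_def field_simps) linarith
      have "v \<in> bad N" if v: "u < v" "v < u'" for v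
      proof -
        have "\<lfloor>v * real n\<rfloor> = \<lfloor>u * real n\<rfloor>"
        proof (rule floor_unique)
          have "u * real n \<le> v * real n" using v n0 by simp
          then show "real_of_int \<lfloor>u * real n\<rfloor> \<le> v * real n" by linarith
          show "v * real n < real_of_int \<lfloor>u * real n\<rfloor> + 1"
            using v(2) n0 by (simp add: u'_def field_simps)
        qed
        with nc n show ?thesis unfolding bad_def by (auto intro!: exI[of _ n])
      qed
      then have "{u<..<u'} \<subseteq> interior (bad N)" by (intro interior_maximal) auto
      moreover obtain v where "u < v" "v < min u' b" using uu' u dense[of u "min u' b"] by auto
      ultimately show False using nbad[of v] u by (auto simp: subset_iff)
    qed
  qed
qed

text \<open>Finitely many rescalings \<open>c * {a<..<b}\<close> of the interval of uniformity cover \<open>[1, 2]\<close>. So for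
\<open>n \<le> j \<le> 2 * n\<close> the values at \<open>j\<close> and \<open>n\<close> can both be compared with the
value at \<open>m = \<lfloor>c * n\<rfloor>\<close>, for one of finitely many scales \<open>c\<close>: with
\<open>j\<close> by uniformity, and with \<open>n\<close> by the limit for the single ratio \<open>c\<close>.\<close>

lemma regularly_varying_comparable_doubling_eventually:
  assumes rv: "regularly_varying \<gamma> \<rho>"
  obtains C n0 where "1 \<le> C" "\<And>n j. n0 \<le> n \<Longrightarrow> n \<le> j \<Longrightarrow> j \<le> 2 * n \<Longrightarrow> comparable C (\<gamma> j) (\<gamma> n)"
proof -
  have pos: "\<gamma> n > 0" if "n \<ge> 1" for n using rv that by (auto simp: regularly_varying_def)
  obtain C a b N where C: "1 \<le> C" and ab: "1 \<le> a" "a < b"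
    and cmp: "\<And>u n. a < u \<Longrightarrow> u < b \<Longrightarrow> N \<le> n \<Longrightarrow> comparable C (\<gamma> (nat \<lfloor>u * real n\<rfloor>)) (\<gamma> n)"
    using regularly_varying_comparable_on_interval[OF rv] by metis
  \<comment> \<open>For \<open>v\<close> in \<open>[1, 2]\<close>, the scales \<open>c\<close> with \<open>a < v / c < b\<close> form an interval of length at least \<open>w\<close>;
    since \<open>2 / K < w\<close>, it contains some \<open>i / K\<close> that stays \<open>1 / K\<close> away from its lower end. This
    distance absorbs the rounding in \<open>m = \<lfloor>c * n\<rfloor>\<close>.\<close>
  define w where "w = 1 / a - 1 / b"
  have w: "w > 0" using ab by (simp add: w_def field_simps)
  obtain K :: nat where K: "2 / w < real K" using reals_Archimedean2 by blast
  have K0: "real K > 0" using w K by (meson divide_pos_pos less_trans zero_less_numeral)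
  have Kw: "2 / real K < w" using K K0 w by (simp add: field_simps)
  have "\<exists>D\<ge>1. \<forall>\<^sub>F n in sequentially. comparable D (\<gamma> (nat \<lfloor>real i / real K * real n\<rfloor>)) (\<gamma> n)"
    if i: "i \<in> {1..2 * K}" for i
  proof -
    define L where "L = (real i / real K) powr \<rho>"
    have L: "L > 0" using i K0 by (simp add: L_def)
    define D where "D = L + 1 / L + 1"
    have D: "D \<ge> 1" using L by (simp add: D_def)
    have "\<forall>\<^sub>F n in sequentially. comparable D (\<gamma> (nat \<lfloor>real i / real K * real n\<rfloor>)) (\<gamma> n)"
    proof (rule comparable_LIMSEQ)
      show "(\<lambda>n. \<gamma> (nat \<lfloor>real i / real K * real n\<rfloor>) / \<gamma> n) \<longlonglongrightarrow> L"
        using rv i K0 unfolding regularly_varying_def L_def by (auto simp del: times_divide_eq_left)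
      have "1 / L < D" using L by (simp add: D_def add_pos_pos)
      then show "1 / D < L" using L D by (simp add: field_simps)
      show "L < D" using L by (simp add: D_def add_pos_pos)
    qed (use D pos in auto)
    with D show ?thesis by blast
  qed
  then obtain D where D: "\<And>i. i \<in> {1..2 * K} \<Longrightarrow> D i \<ge> 1 \<and>
      (\<forall>\<^sub>F n in sequentially. comparable (D i) (\<gamma> (nat \<lfloor>real i / real K * real n\<rfloor>)) (\<gamma> n))"
    by metis
  define D' where "D' = sum D {1..2 * K} + 1"
  have DD: "D i \<le> D'" if "i \<in> {1..2 * K}" for i
    using member_le_sum[of i "{1..2 * K}" D] D that by (force simp: D'_def)
  have D'1: "D' \<ge> 1"
  proof -
    have "0 \<le> sum D {1..2 * K}" using D by (intro sum_nonneg) (metis order_trans zero_le_one)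
    then show ?thesis by (simp add: D'_def)
  qed
  have "\<forall>\<^sub>F n in sequentially. \<forall>i\<in>{1..2 * K}. comparable (D i) (\<gamma> (nat \<lfloor>real i / real K * real n\<rfloor>)) (\<gamma> n)"
    using D by (intro eventually_ball_finite) auto
  then obtain N' where N': "\<And>n i. n \<ge> N' \<Longrightarrow> i \<in> {1..2 * K} \<Longrightarrow>
      comparable (D i) (\<gamma> (nat \<lfloor>real i / real K * real n\<rfloor>)) (\<gamma> n)"
    unfolding eventually_sequentially by blast
  define n0 where "n0 = max N' (K * (N + 2))"
  show ?thesis
  proof (rule that[of "C * D'" n0])
    show "1 \<le> C * D'" using mult_mono[OF C D'1] C by simp
    fix n j assume n: "n0 \<le> n" and j: "n \<le> j" "j \<le> 2 * n"
    have nK: "real n \<ge> real K * (real N + 2)"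
    proof -
      have "K * (N + 2) \<le> n" using n by (simp add: n0_def)
      then have "real (K * (N + 2)) \<le> real n" by (rule of_nat_mono)
      then show ?thesis by (simp add: algebra_simps)
    qed
    have "0 < real K * (real N + 2)" using K0 by (intro mult_pos_pos) auto
    then have np: "real n > 0" using nK by linarith
    define v where "v = real j / real n"
    have v: "1 \<le> v" "v \<le> 2" using j np by (auto simp: v_def field_simps)
    define i where "i = nat \<lfloor>real K * v / b\<rfloor> + 2"
    have nn: "0 \<le> real K * v / b" using K0 v ab by auto
    have i1: "real i \<le> real K * v / b + 2" using nn by (simp add: i_def)
    have i2: "real K * v / b + 1 < real i" using nn by (simp add: i_def) linarith
    define c where "c = real i / real K"
    have cl: "v / b + 1 / real K < c" 
      using divide_strict_right_mono[OF i2 K0] K0 by (simp add: c_def add_divide_distrib)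
    have cu: "c < v / a"
    proof -
      have "c \<le> v / b + 2 / real K" 
        using divide_right_mono[OF i1, of "real K"] K0 by (simp add: c_def add_divide_distrib)
      also have "\<dots> < v / b + w" using Kw by simp
      also have "\<dots> \<le> v / b + v * w" using v w by simp
      also have "\<dots> = v / a" by (simp add: w_def field_simps)
      finally show ?thesis .
    qed
    have "v / a \<le> 2" using v ab mult_mono[of v 2 1 a] by (simp add: field_simps)
    then have "c < 2" using cu by simp
    then have iK: "i \<in> {1..2 * K}" using K0 by (simp add: c_def i_def field_simps)
    define m where "m = nat \<lfloor>c * real n\<rfloor>"
    have c0: "c > 1 / real K" using cl v ab by (smt (verit) divide_nonneg_pos)
    have cn: "0 \<le> c * real n" using c0 K0 np by (smt (verit) divide_pos_pos mult_nonneg_nonneg)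
    have m1: "real m \<le> c * real n" using cn by (simp add: m_def)
    have m2: "c * real n - 1 < real m" using cn unfolding m_def by linarith
    have "real N + 2 \<le> 1 / real K * real n" using nK K0 by (simp add: field_simps)
    also have "\<dots> \<le> c * real n" using c0 np by (intro mult_right_mono) auto
    finally have mN: "N + 1 < m" using m2 by linarith
    have mp: "real m > 0" using mN by simp
    define u where "u = real j / real m"
    have ua: "a < u"
    proof -
      have "a * real m \<le> a * (c * real n)" using m1 ab by simp
      also have "\<dots> < v * real n" using cu ab np by (simp add: field_simps)
      also have "\<dots> = real j" using np by (simp add: v_def)
      finally show ?thesis using mp by (simp add: u_def field_simps)
    qed
    have ub: "u < b"
    proof -
      have "1 \<le> real N + 2" by simp
      also have "\<dots> \<le> 1 / real K * real n" by fact
      finally have "v / b * real n + 1 \<le> (v / b + 1 / real K) * real n" by (simp add: algebra_simps)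
      also have "\<dots> < c * real n" using cl np by simp
      finally have "v / b * real n < real m" using m2 by simp
      then have "v * real n < b * real m" using ab by (simp add: field_simps)
      then show ?thesis using mp np by (simp add: u_def v_def field_simps)
    qed
    have "comparable C (\<gamma> (nat \<lfloor>u * real m\<rfloor>)) (\<gamma> m)" using cmp[OF ua ub] mN by simp
    moreover have "u * real m = real j" using mp by (simp add: u_def)
    ultimately have "comparable C (\<gamma> j) (\<gamma> m)" by simp
    moreover have "comparable D' (\<gamma> m) (\<gamma> n)"
    proof (rule comparable_mono[OF _ DD[OF iK]])
      show "comparable (D i) (\<gamma> m) (\<gamma> n)" unfolding m_def c_def
        using iK n by (intro N') (auto simp: n0_def)
      show "0 \<le> \<gamma> m" "0 \<le> \<gamma> n" using pos[of m] pos[of n] mN np by (auto simp: less_imp_le)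
    qed
    ultimately show "comparable (C * D') (\<gamma> j) (\<gamma> n)"
      using C D'1 by (intro comparable_trans) auto
  qed
qed

lemma regularly_varying_comparable_doubling:
  assumes rv: "regularly_varying \<gamma> \<rho>"
  obtains C where "1 \<le> C" "\<And>n j. 1 \<le> n \<Longrightarrow> n \<le> j \<Longrightarrow> j \<le> 2 * n \<Longrightarrow> comparable C (\<gamma> j) (\<gamma> n)"
proof -
  have pos: "\<gamma> n > 0" if "n \<ge> 1" for n using rv that by (auto simp: regularly_varying_def)
  obtain C n0 where C: "1 \<le> C"
    and cmp: "\<And>n j. n0 \<le> n \<Longrightarrow> n \<le> j \<Longrightarrow> j \<le> 2 * n \<Longrightarrow> comparable C (\<gamma> j) (\<gamma> n)"
    using regularly_varying_comparable_doubling_eventually[OF rv] by metis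
  define Q where "Q = (\<lambda>(i, j). \<gamma> i / \<gamma> j) ` ({1..2 * n0} \<times> {1..2 * n0})"
  define D where "D = Max (insert C Q)"
  have fQ: "finite Q" by (simp add: Q_def)
  have CD: "C \<le> D" using fQ by (simp add: D_def)
  have D: "\<gamma> i \<le> D * \<gamma> j" if "i \<in> {1..2 * n0}" "j \<in> {1..2 * n0}" for i j
  proof -
    have "\<gamma> i / \<gamma> j \<in> insert C Q" using that by (force simp: Q_def)
    then have "\<gamma> i / \<gamma> j \<le> D" unfolding D_def by (rule Max_ge[rotated]) (simp add: fQ)
    then show ?thesis using pos[of j] that by (simp add: field_simps)
  qed
  show ?thesis
  proof (rule that[of D])
    show "1 \<le> D" using C CD by simp
    fix n j :: nat assume n: "1 \<le> n" "n \<le> j" "j \<le> 2 * n"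
    show "comparable D (\<gamma> j) (\<gamma> n)"
    proof (cases "n0 \<le> n")
      case True
      then show ?thesis using cmp[of n j] n pos[of n] pos[of j] CD
        by (auto intro: comparable_mono)
    next
      case False
      then show ?thesis using n D by (auto simp: comparable_def)
    qed
  qed
qed

text \<open>Iterating the comparison over a factor 2 reaches every fixed factor \<open>1 / \<delta>\<close>.\<close>

lemma regularly_varying_comparable:
  assumes rv: "regularly_varying \<gamma> \<rho>" and \<delta>: "0 < \<delta>"
  obtains C where "1 \<le> C"
    "\<And>n j. 1 \<le> j \<Longrightarrow> \<delta> * real n \<le> real j \<Longrightarrow> j \<le> n \<Longrightarrow> comparable C (\<gamma> j) (\<gamma> n)"
proof -
  obtain C where C: "1 \<le> C"
    and cmp: "\<And>n j. 1 \<le> n \<Longrightarrow> n \<le> j \<Longrightarrow> j \<le> 2 * n \<Longrightarrow> comparable C (\<gamma> j) (\<gamma> n)"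
    using regularly_varying_comparable_doubling[OF rv] by metis
  have iter: "comparable (C ^ Suc i) (\<gamma> j) (\<gamma> n)" if "1 \<le> n" "n \<le> j" "j \<le> 2 ^ Suc i * n" for n j i
    using that
  proof (induction i arbitrary: j)
    case 0
    then show ?case using cmp by simp
  next
    case (Suc i)
    define m where "m = max n ((j + 1) div 2)"
    have "j \<le> 2 * (2 ^ Suc i * n)" using Suc.prems by simp
    then have "(j + 1) div 2 \<le> 2 ^ Suc i * n" by linarith
    moreover have "n \<le> 2 ^ Suc i * n" by simp
    ultimately have "comparable (C ^ Suc i) (\<gamma> m) (\<gamma> n)"
      using Suc.prems by (intro Suc.IH) (auto simp: m_def)
    moreover have "comparable C (\<gamma> j) (\<gamma> m)"
      using Suc.prems by (intro cmp) (auto simp: m_def)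
    ultimately show ?case
      using comparable_trans[of C "\<gamma> j" "\<gamma> m" "C ^ Suc i" "\<gamma> n"] C by simp
  qed
  obtain i where i: "1 / \<delta> < 2 ^ Suc i"
  proof -
    obtain i where "1 / \<delta> < 2 ^ i" using real_arch_pow[of 2 "1 / \<delta>"] by auto
    also have "(2::real) ^ i \<le> 2 ^ Suc i" by simp
    finally show thesis by (rule that)
  qed
  show ?thesis
  proof (rule that[of "C ^ Suc i"])
    show "1 \<le> C ^ Suc i" using C by (simp add: one_le_power del: power_Suc)
    fix n j :: nat assume j: "1 \<le> j" "\<delta> * real n \<le> real j" "j \<le> n"
    have "real n \<le> 1 / \<delta> * real j" using j \<delta> by (simp add: field_simps)
    also have "\<dots> \<le> 2 ^ Suc i * real j" using less_imp_le[OF i] j by (intro mult_right_mono) auto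
    finally have "real n \<le> real (2 ^ Suc i * j)" by simp
    then have "n \<le> 2 ^ Suc i * j" by (rule of_nat_le_iff[THEN iffD1])
    then show "comparable (C ^ Suc i) (\<gamma> j) (\<gamma> n)"
      using iter[of j n i] j by (simp add: comparable_sym)
  qed
qed

lemma regularly_varying_inverse:
  assumes "regularly_varying \<gamma> \<rho>"
  shows "regularly_varying (\<lambda>n. 1 / \<gamma> n) (- \<rho>)"
  unfolding regularly_varying_def
proof (intro conjI allI impI)
  fix u :: real assume u: "u > 0"
  have "(\<lambda>n. inverse (\<gamma> (nat \<lfloor>u * real n\<rfloor>) / \<gamma> n)) \<longlonglongrightarrow> inverse (u powr \<rho>)"
    using assms u by (intro tendsto_inverse) (auto simp: regularly_varying_def)
  then show "(\<lambda>n. 1 / \<gamma> (nat \<lfloor>u * real n\<rfloor>) / (1 / \<gamma> n)) \<longlonglongrightarrow> u powr - \<rho>"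
    by (simp add: powr_minus divide_inverse mult.commute)
qed (use assms in \<open>auto simp: regularly_varying_def\<close>)

lemma regularly_varying_doubling_tendsto:
  assumes "regularly_varying \<gamma> \<rho>"
  shows "(\<lambda>n. \<gamma> (2 * n) / \<gamma> n) \<longlonglongrightarrow> 2 powr \<rho>"
proof -
  have "nat \<lfloor>2 * real n\<rfloor> = 2 * n" for n by linarith
  moreover have "(\<lambda>n. \<gamma> (nat \<lfloor>2 * real n\<rfloor>) / \<gamma> n) \<longlonglongrightarrow> 2 powr \<rho>"
    using assms unfolding regularly_varying_def by force
  ultimately show ?thesis by simp
qed

text \<open>A one-sided Potter bound: along \<open>2 ^ i * n0\<close> the sequence grows at least like
\<open>(2 powr a) ^ i\<close>, because the doubling ratio tends to \<open>2 powr \<rho> > 2 powr a\<close>, and in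
between it changes by a bounded factor.\<close>

lemma regularly_varying_lower_powr:
  assumes rv: "regularly_varying \<gamma> \<rho>" and a: "a < \<rho>"
  obtains c where "0 < c" "\<forall>\<^sub>F n in sequentially. c * real n powr a \<le> \<gamma> n"
proof -
  have pos: "\<gamma> n > 0" if "n \<ge> 1" for n using rv that by (auto simp: regularly_varying_def)
  obtain C where C: "1 \<le> C"
    and cmp: "\<And>n j. 1 \<le> n \<Longrightarrow> n \<le> j \<Longrightarrow> j \<le> 2 * n \<Longrightarrow> comparable C (\<gamma> j) (\<gamma> n)"
    using regularly_varying_comparable_doubling[OF rv] by metis
  have "2 powr a < 2 powr \<rho>" using a by simp
  from order_tendstoD(1)[OF regularly_varying_doubling_tendsto[OF rv] this]
  obtain n1 where n1: "\<And>n. n \<ge> n1 \<Longrightarrow> 2 powr a < \<gamma> (2 * n) / \<gamma> n"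
    by (auto simp: eventually_sequentially)
  define n0 where "n0 = max 1 n1"
  have n0: "n0 \<ge> 1" by (simp add: n0_def)
  have dbl: "2 powr a * \<gamma> n \<le> \<gamma> (2 * n)" if "n \<ge> n0" for n
    using n1[of n] pos[of n] that by (auto simp: n0_def field_simps)
  have pow: "(2 powr a) ^ i * \<gamma> n0 \<le> \<gamma> (2 ^ i * n0)" for i
  proof (induction i)
    case (Suc i)
    have "(2 powr a) ^ Suc i * \<gamma> n0 \<le> 2 powr a * \<gamma> (2 ^ i * n0)"
      using Suc by (simp add: mult.assoc)
    also have "\<dots> \<le> \<gamma> (2 * (2 ^ i * n0))" by (intro dbl) simp
    finally show ?case by (simp add: mult.assoc)
  qed simp
  define c where "c = \<gamma> n0 / (C * 2 powr \<bar>a\<bar> * real n0 powr a)"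
  show ?thesis
  proof (rule that)
    show "0 < c" using pos[OF n0] n0 C by (simp add: c_def)
    have "c * real n powr a \<le> \<gamma> n" if n: "n \<ge> n0" for n
    proof -
      have "1 \<le> n div n0" using n n0 by (simp add: Suc_leI div_greater_zero_iff)
      then obtain i where i: "2 ^ i \<le> n div n0" "n div n0 < 2 ^ (i + 1)"
        using ex_power_ivl1[of 2 "n div n0"] by auto
      define m where "m = 2 ^ i * n0"
      have mn: "m \<le> n" using i(1) n0 by (simp add: m_def less_eq_div_iff_mult_less_eq)
      have nm: "n < 2 * m" using i(2) n0 by (simp add: m_def div_less_iff_less_mult mult.assoc)
      have m1: "1 \<le> m" using n0 by (simp add: m_def)
      have "real n powr a = (real n / real m) powr a * real m powr a"
        using m1 by (simp add: powr_divide)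
      also have "(real n / real m) powr a \<le> 2 powr \<bar>a\<bar>"
      proof -
        have q: "1 \<le> real n / real m" "real n / real m \<le> 2" using mn nm m1 by (auto simp: field_simps)
        then have "(real n / real m) powr a \<le> (real n / real m) powr \<bar>a\<bar>" by (intro powr_mono) auto
        also have "\<dots> \<le> 2 powr \<bar>a\<bar>" using q by (intro powr_mono2) auto
        finally show ?thesis .
      qed
      finally have "real n powr a \<le> 2 powr \<bar>a\<bar> * real m powr a" by (simp add: mult_right_mono)
      also have "real m powr a = (2 powr a) ^ i * real n0 powr a"
        by (simp add: m_def powr_mult powr_power powr_realpow[symmetric] powr_powr mult.commute)
      finally have "c * real n powr a \<le> c * (2 powr \<bar>a\<bar> * ((2 powr a) ^ i * real n0 powr a))"
        using \<open>0 < c\<close> by simp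
      also have "\<dots> = (2 powr a) ^ i * \<gamma> n0 / C" using n0 by (simp add: c_def)
      also have "\<dots> \<le> \<gamma> m / C" using pow[of i] C by (simp add: m_def divide_right_mono)
      also have "\<dots> \<le> \<gamma> n" using cmp[of m n] mn nm m1 C
        by (auto simp: comparable_def field_simps)
      finally show ?thesis .
    qed
    then show "\<forall>\<^sub>F n in sequentially. c * real n powr a \<le> \<gamma> n"
      by (auto simp: eventually_sequentially)
  qed
qed

lemma regularly_varying_upper_powr:
  assumes rv: "regularly_varying \<gamma> \<rho>" and a: "\<rho> < a"
  obtains c where "0 < c" "\<forall>\<^sub>F n in sequentially. \<gamma> n \<le> c * real n powr a"
proof -
  have pos: "\<gamma> n > 0" if "n \<ge> 1" for n using rv that by (auto simp: regularly_varying_def)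
  obtain c where c: "0 < c" and ev: "\<forall>\<^sub>F n in sequentially. c * real n powr (- a) \<le> 1 / \<gamma> n"
    using regularly_varying_lower_powr[OF regularly_varying_inverse[OF rv], of "- a"] a by auto
  show ?thesis
  proof (rule that)
    show "0 < 1 / c" using c by simp
    show "\<forall>\<^sub>F n in sequentially. \<gamma> n \<le> 1 / c * real n powr a"
      using ev eventually_ge_at_top[of 1]
    proof eventually_elim
      case (elim n)
      then show ?case using c pos[of n] by (simp add: powr_minus field_simps)
    qed
  qed
qed

section \<open>Tails of a regularly varying law\<close>

lemma tail_antimono: "i \<le> j \<Longrightarrow> tail \<mu> j \<le> tail \<mu> i"
  unfolding tail_def by (intro measure_pmf.finite_measure_mono) auto

lemma tail_nonneg: "0 \<le> tail \<mu> j" and tail_le_1: "tail \<mu> j \<le> 1"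
  by (simp_all add: tail_def)

lemma tail_split:
  assumes "i \<le> j" shows "tail \<mu> i = (\<Sum>k=i..<j. pmf \<mu> k) + tail \<mu> j"
proof -
  have "{i..} = {i..<j} \<union> {j..}" using assms by auto
  then have "tail \<mu> i = measure_pmf.prob \<mu> {i..<j} + tail \<mu> j"
    unfolding tail_def by (subst measure_pmf.finite_measure_Union[symmetric]) auto
  then show ?thesis by (simp add: measure_measure_pmf_finite)
qed

lemma tail_tendsto_0: "tail \<mu> \<longlonglongrightarrow> 0"
proof -
  have "(\<lambda>i. measure_pmf.prob \<mu> {i..}) \<longlonglongrightarrow> measure_pmf.prob \<mu> (\<Inter>i. {i..})"
    by (intro measure_pmf.finite_Lim_measure_decseq) (auto simp: decseq_def)
  moreover have "(\<Inter>i::nat. {i..}) = {}" using not_less_eq_eq by auto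
  ultimately show ?thesis by (simp add: tail_def[abs_def])
qed

locale regularly_varying_law =
  fixes \<mu> :: "nat pmf" and \<alpha> :: real
  assumes set_pmf_pos: "set_pmf \<mu> \<subseteq> {1..}"
    and index_ge_1: "\<alpha> \<ge> 1"
    and regularly_varying_pmf: "regularly_varying (pmf \<mu>) (- \<alpha>)"
begin

text \<open>The order of magnitude of the mass that the law gives to \<open>{n<..2 * n}\<close>; regularly varying of index
\<open>1 - \<alpha>\<close>.\<close>

definition g :: "nat \<Rightarrow> real" where "g n = real n * pmf \<mu> n"

lemma pmf_pos: "1 \<le> n \<Longrightarrow> pmf \<mu> n > 0"
  using regularly_varying_pmf by (auto simp: regularly_varying_def)

lemma g_nonneg: "0 \<le> g n" by (simp add: g_def)

lemma tail_ge_g: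
  obtains c where "0 < c" "\<And>n. 1 \<le> n \<Longrightarrow> c * g n \<le> tail \<mu> (Suc n)"
proof -
  obtain C where C: "1 \<le> C"
    and cmp: "\<And>n j. 1 \<le> n \<Longrightarrow> n \<le> j \<Longrightarrow> j \<le> 2 * n \<Longrightarrow> comparable C (pmf \<mu> j) (pmf \<mu> n)"
    using regularly_varying_comparable_doubling[OF regularly_varying_pmf] by metis
  show ?thesis
  proof (rule that)
    show "0 < 1 / C" using C by simp
    fix n :: nat assume n: "1 \<le> n"
    have "1 / C * g n = (\<Sum>k=Suc n..<Suc (2 * n). pmf \<mu> n / C)" by (simp add: g_def)
    also have "\<dots> \<le> (\<Sum>k=Suc n..<Suc (2 * n). pmf \<mu> k)"
      using cmp n C by (intro sum_mono) (force simp: comparable_def field_simps)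
    also have "\<dots> \<le> tail \<mu> (Suc n)"
      using n by (subst tail_split[of "Suc n" "Suc (2 * n)"]) (auto simp: tail_nonneg)
    finally show "1 / C * g n \<le> tail \<mu> (Suc n)" .
  qed
qed

text \<open>Split the tail into dyadic blocks. The block \<open>{n..<2 * n}\<close> has mass at most \<open>C * g n\<close>, and for
\<open>\<alpha> > 1\<close> the values of \<open>g\<close> at \<open>n, 2 * n, 4 * n, ...\<close> decrease
geometrically.\<close>

lemma tail_le_g:
  assumes "1 < \<alpha>"
  obtains K where "0 < K" "\<forall>\<^sub>F n in sequentially. tail \<mu> n \<le> K * g n"
proof -
  obtain C where C: "1 \<le> C"
    and cmp: "\<And>n j. 1 \<le> n \<Longrightarrow> n \<le> j \<Longrightarrow> j \<le> 2 * n \<Longrightarrow> comparable C (pmf \<mu> j) (pmf \<mu> n)"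
    using regularly_varying_comparable_doubling[OF regularly_varying_pmf] by metis
  \<comment> \<open>Any exponent strictly between \<open>1\<close> and \<open>\<alpha>\<close> gives a geometric ratio \<open>r < 1\<close>.\<close>
  define a where "a = (1 + \<alpha>) / 2"
  define r where "r = 2 powr (1 - a)"
  have r: "0 < r" "r < 1" using assms by (auto simp: r_def a_def powr_less_one)
  have "2 powr (- \<alpha>) < 2 powr (- a)" using assms by (simp add: a_def)
  from order_tendstoD(2)[OF regularly_varying_doubling_tendsto[OF regularly_varying_pmf] this]
  obtain n1 where n1: "\<And>n. n \<ge> n1 \<Longrightarrow> pmf \<mu> (2 * n) / pmf \<mu> n < 2 powr (- a)"
    by (auto simp: eventually_sequentially)
  define n0 where "n0 = max 1 n1"
  have g2: "g (2 * n) \<le> r * g n" if n: "n \<ge> n0" for n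
  proof -
    have "pmf \<mu> (2 * n) \<le> 2 powr (- a) * pmf \<mu> n"
      using n1[of n] pmf_pos[of n] n by (auto simp: n0_def field_simps)
    then have "2 * real n * pmf \<mu> (2 * n) \<le> 2 * real n * (2 powr (- a) * pmf \<mu> n)"
      by (intro mult_left_mono) auto
    then show ?thesis by (simp add: g_def r_def powr_diff powr_minus field_simps)
  qed
  have gp: "g (2 ^ i * n) \<le> r ^ i * g n" if n: "n \<ge> n0" for n i
  proof (induction i)
    case (Suc i)
    have "g (2 * (2 ^ i * n)) \<le> r * g (2 ^ i * n)" by (intro g2 order_trans[OF n]) simp
    also have "\<dots> \<le> r * (r ^ i * g n)" using Suc r by simp
    finally show ?case by (simp add: mult.assoc)
  qed simp
  have step: "tail \<mu> n \<le> C * g n + tail \<mu> (2 * n)" if n: "n \<ge> 1" for n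
  proof -
    have "tail \<mu> n = (\<Sum>k=n..<2*n. pmf \<mu> k) + tail \<mu> (2 * n)" by (rule tail_split) simp
    also have "(\<Sum>k=n..<2*n. pmf \<mu> k) \<le> (\<Sum>k=n..<2*n. C * pmf \<mu> n)"
      using cmp n by (intro sum_mono) (force simp: comparable_def)
    finally show ?thesis by (simp add: g_def mult_ac)
  qed
  have sums: "tail \<mu> n \<le> C * (\<Sum>j<i. r ^ j * g n) + tail \<mu> (2 ^ i * n)" if n: "n \<ge> n0" for n i
  proof (induction i)
    case (Suc i)
    have "tail \<mu> (2 ^ i * n) \<le> C * g (2 ^ i * n) + tail \<mu> (2 * (2 ^ i * n))"
      using n by (intro step) (auto simp: n0_def)
    moreover have "C * g (2 ^ i * n) \<le> C * (r ^ i * g n)" using gp[OF n] C by (intro mult_left_mono) auto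
    ultimately show ?case using Suc by (simp add: algebra_simps)
  qed simp
  have main: "tail \<mu> n \<le> C / (1 - r) * g n" if n: "n \<ge> n0" for n
  proof (rule LIMSEQ_le_const)
    have n1: "n \<ge> 1" using n by (simp add: n0_def)
    have sm: "strict_mono (\<lambda>i. 2 ^ i * n)" using n1 by (intro strict_monoI) auto
    have "(\<lambda>i. tail \<mu> (2 ^ i * n)) \<longlonglongrightarrow> 0"
      using LIMSEQ_subseq_LIMSEQ[OF tail_tendsto_0 sm] by (simp add: o_def)
    then have "(\<lambda>i. C / (1 - r) * g n + tail \<mu> (2 ^ i * n)) \<longlonglongrightarrow> C / (1 - r) * g n + 0"
      by (intro tendsto_intros)
    then show "(\<lambda>i. C / (1 - r) * g n + tail \<mu> (2 ^ i * n)) \<longlonglongrightarrow> C / (1 - r) * g n" by simp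
    have "tail \<mu> n \<le> C / (1 - r) * g n + tail \<mu> (2 ^ i * n)" for i
    proof -
      have "(\<Sum>j<i. r ^ j) \<le> (\<Sum>j. r ^ j)" using r by (intro sum_le_suminf) (auto simp: summable_geometric)
      also have "\<dots> = 1 / (1 - r)" using r by (intro suminf_geometric) auto
      finally have "C * g n * (\<Sum>j<i. r ^ j) \<le> C * g n * (1 / (1 - r))"
        using C g_nonneg by (intro mult_left_mono) auto
      moreover have "(\<Sum>j<i. r ^ j * g n) = (\<Sum>j<i. r ^ j) * g n" by (rule sum_distrib_right[symmetric])
      ultimately show ?thesis using sums[OF n, of i] by (simp add: mult_ac)
    qed
    then show "\<exists>N. \<forall>i\<ge>N. tail \<mu> n \<le> C / (1 - r) * g n + tail \<mu> (2 ^ i * n)" by blast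
  qed
  show ?thesis
  proof (rule that)
    show "0 < C / (1 - r)" using C r by simp
    show "\<forall>\<^sub>F n in sequentially. tail \<mu> n \<le> C / (1 - r) * g n"
      using main by (auto simp: eventually_sequentially)
  qed
qed

lemma g_upper_powr:
  assumes "b < \<alpha> - 1"
  obtains c where "0 < c" "\<forall>\<^sub>F n in sequentially. g n \<le> c * real n powr (- b)"
proof -
  obtain c where c: "0 < c" and ev: "\<forall>\<^sub>F n in sequentially. pmf \<mu> n \<le> c * real n powr (- b - 1)"
    using regularly_varying_upper_powr[OF regularly_varying_pmf, of "- b - 1"] assms by auto
  have "\<forall>\<^sub>F n in sequentially. g n \<le> c * real n powr (- b)"
    using ev eventually_ge_at_top[of 1]
  proof eventually_elim
    case (elim n)
    then have "g n \<le> real n * (c * real n powr (- b - 1))" unfolding g_def by (intro mult_left_mono) auto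
    also have "\<dots> = c * real n powr (- b)" using elim by (simp add: powr_diff)
    finally show ?case .
  qed
  with c show ?thesis by (rule that)
qed

lemma g_lower_powr:
  assumes "\<alpha> - 1 < b"
  obtains c where "0 < c" "\<forall>\<^sub>F n in sequentially. c * real n powr (- b) \<le> g n"
proof -
  obtain c where c: "0 < c" and ev: "\<forall>\<^sub>F n in sequentially. c * real n powr (- b - 1) \<le> pmf \<mu> n"
    using regularly_varying_lower_powr[OF regularly_varying_pmf, of "- b - 1"] assms by auto
  have "\<forall>\<^sub>F n in sequentially. c * real n powr (- b) \<le> g n"
    using ev eventually_ge_at_top[of 1]
  proof eventually_elim
    case (elim n)
    then have "real n * (c * real n powr (- b - 1)) \<le> g n" unfolding g_def by (intro mult_left_mono) auto
    moreover have "real n * (c * real n powr (- b - 1)) = c * real n powr (- b)" using elim by (simp add: powr_diff)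
    ultimately show ?case by simp
  qed
  with c show ?thesis by (rule that)
qed

lemma summable_g_power:
  assumes "1 < real h * (\<alpha> - 1)"
  shows "summable (\<lambda>n. g n ^ h)"
proof -
  have h: "real h > 0" using assms by (cases h) auto
  define b where "b = (1 / real h + (\<alpha> - 1)) / 2"
  have b: "b < \<alpha> - 1" "1 < real h * b"
  proof -
    have "1 / real h < \<alpha> - 1" using assms h by (simp add: field_simps)
    then show "b < \<alpha> - 1" by (simp add: b_def)
    have "real h * b = (1 + real h * (\<alpha> - 1)) / 2" using h by (simp add: b_def distrib_left)
    with assms show "1 < real h * b" by simp
  qed
  obtain c where c: "0 < c" and ev: "\<forall>\<^sub>F n in sequentially. g n \<le> c * real n powr (- b)"
    using g_upper_powr[OF b(1)] by metis
  show ?thesis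
  proof (rule summable_comparison_test_ev)
    show "summable (\<lambda>n. c ^ h * real n powr (- (real h * b)))"
      using b by (intro summable_mult) (simp add: summable_real_powr_iff)
    show "\<forall>\<^sub>F n in sequentially. norm (g n ^ h) \<le> c ^ h * real n powr (- (real h * b))"
      using ev
    proof eventually_elim
      case (elim n)
      then have "g n ^ h \<le> (c * real n powr (- b)) ^ h" by (intro power_mono g_nonneg)
      also have "\<dots> = c ^ h * real n powr (- (real h * b))"
        using h by (cases "n = 0") (auto simp: power_mult_distrib powr_power mult.commute power_0_left)
      finally show ?case by (simp add: g_nonneg)
    qed
  qed
qed

lemma not_summable_g_power_index_1:
  assumes "\<alpha> = 1" "1 \<le> h"
  shows "\<not> summable (\<lambda>n. g n ^ h)"
proof
  assume s: "summable (\<lambda>n. g n ^ h)"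
  obtain c where c: "0 < c" and ev: "\<forall>\<^sub>F n in sequentially. c * real n powr (- (1 / real h)) \<le> g n"
    using g_lower_powr[of "1 / real h"] assms by auto
  have "summable (\<lambda>n. c ^ h * real n powr (- 1))"
  proof (rule summable_comparison_test_ev[OF _ s])
    show "\<forall>\<^sub>F n in sequentially. norm (c ^ h * real n powr (- 1)) \<le> g n ^ h"
      using ev
    proof eventually_elim
      case (elim n)
      then have "(c * real n powr (- (1 / real h))) ^ h \<le> g n ^ h" using c by (intro power_mono) auto
      moreover have "(c * real n powr (- (1 / real h))) ^ h = c ^ h * real n powr (- 1)"
        using assms(2) 
        by (cases "n = 0") (auto simp: power_mult_distrib powr_power power_0_left)
      ultimately show ?case using c by simp
    qed
  qed
  then have "summable (\<lambda>n. real n powr (- 1))" using c by (subst (asm) summable_cmult_iff) auto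
  then show False by (simp only: summable_real_powr_iff)
qed

text \<open>For \<open>\<alpha> > 1\<close> the two sequences are comparable. For \<open>\<alpha> = 1\<close> the tail may be much
larger than \<open>g\<close>, but then neither series converges.\<close>

lemma summable_tail_power_iff:
  assumes h: "1 \<le> h"
  shows "summable (\<lambda>n. tail \<mu> n ^ h) \<longleftrightarrow> summable (\<lambda>n. g n ^ h)"
proof
  assume s: "summable (\<lambda>n. tail \<mu> n ^ h)"
  obtain c where c: "0 < c" and le: "\<And>n. 1 \<le> n \<Longrightarrow> c * g n \<le> tail \<mu> (Suc n)"
    using tail_ge_g by metis
  have "summable (\<lambda>n. c ^ h * g n ^ h)"
  proof (rule summable_comparison_test_ev[OF _ s])
    show "\<forall>\<^sub>F n in sequentially. norm (c ^ h * g n ^ h) \<le> tail \<mu> n ^ h"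
      using eventually_ge_at_top[of 1]
    proof eventually_elim
      case (elim n)
      then have "c * g n \<le> tail \<mu> n" using le[of n] tail_antimono[of n "Suc n" \<mu>] by simp
      then have "(c * g n) ^ h \<le> tail \<mu> n ^ h" using c g_nonneg[of n] by (intro power_mono) auto
      then show ?case using c g_nonneg[of n] by (simp add: power_mult_distrib)
    qed
  qed
  then show "summable (\<lambda>n. g n ^ h)" using c by (subst (asm) summable_cmult_iff) auto
next
  assume s: "summable (\<lambda>n. g n ^ h)"
  then have "1 < \<alpha>" using not_summable_g_power_index_1[OF _ h] index_ge_1 by force
  then obtain K where K: "0 < K" and ev: "\<forall>\<^sub>F n in sequentially. tail \<mu> n \<le> K * g n"
    using tail_le_g by metis
  show "summable (\<lambda>n. tail \<mu> n ^ h)"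
  proof (rule summable_comparison_test_ev)
    show "summable (\<lambda>n. K ^ h * g n ^ h)" using s by (rule summable_mult)
    show "\<forall>\<^sub>F n in sequentially. norm (tail \<mu> n ^ h) \<le> K ^ h * g n ^ h"
      using ev
    proof eventually_elim
      case (elim n)
      then have "tail \<mu> n ^ h \<le> (K * g n) ^ h" by (intro power_mono tail_nonneg)
      then show ?case by (simp add: power_mult_distrib tail_nonneg)
    qed
  qed
qed

lemma exists_summable_tail_power:
  assumes "1 < \<alpha>"
  obtains h where "1 \<le> h" "summable (\<lambda>n. tail \<mu> n ^ h)"
proof -
  obtain h :: nat where "1 / (\<alpha> - 1) < real h" using reals_Archimedean2 by blast
  then have h: "1 < real h * (\<alpha> - 1)" using assms by (simp add: field_simps)
  then have "1 \<le> h" by (cases h) auto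
  then show ?thesis using that summable_tail_power_iff summable_g_power[OF h] by blast
qed

text \<open>Divergence of \<open>\<Sum>n. g n ^ h\<close> forces \<open>h * (\<alpha> - 1) \<le> 1\<close>, so that
\<open>k * (\<alpha> - 1) < 1\<close> for \<open>k < h\<close>. This strict inequality is what makes the number of hits
of bin \<open>k\<close> grow like a power of \<open>n\<close>, fast enough for almost sure lower bounds.\<close>

lemma n_g_power_lower_powr:
  assumes "\<not> summable (\<lambda>n. g n ^ h)" "k < h"
  obtains c e where "0 < c" "0 < e" "\<forall>\<^sub>F n in sequentially. c * real n powr e \<le> real n * g n ^ k"
proof -
  have "real h * (\<alpha> - 1) \<le> 1" using summable_g_power[of h] assms(1) by linarith
  then have k: "real k * (\<alpha> - 1) < 1"
  proof (cases "\<alpha> = 1")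
    case False
    then have "real k * (\<alpha> - 1) < real h * (\<alpha> - 1)" using assms(2) index_ge_1 by simp
    with \<open>real h * (\<alpha> - 1) \<le> 1\<close> show ?thesis by linarith
  qed simp
  \<comment> \<open>The exponent \<open>b\<close> exceeds \<open>\<alpha> - 1\<close> by so little that still \<open>k * b < 1\<close>.\<close>
  define b where "b = (\<alpha> - 1) + (1 - real k * (\<alpha> - 1)) / (2 * (real k + 1))"
  have "real k * b = real k * (\<alpha> - 1) + (real k / (real k + 1)) * ((1 - real k * (\<alpha> - 1)) / 2)"
    by (simp add: b_def distrib_left field_simps)
  also have "\<dots> \<le> real k * (\<alpha> - 1) + 1 * ((1 - real k * (\<alpha> - 1)) / 2)"
    using k by (intro add_left_mono mult_right_mono) auto
  also have "\<dots> < 1"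
  proof -
    have "t + 1 * ((1 - t) / 2) < 1" if "t < 1" for t :: real using that by (simp add: field_simps)
    from this[OF k] show ?thesis .
  qed
  finally have b: "real k * b < 1" .
  have "\<alpha> - 1 < b" using k by (simp add: b_def)
  then obtain c where c: "0 < c" and ev: "\<forall>\<^sub>F n in sequentially. c * real n powr (- b) \<le> g n"
    using g_lower_powr by metis
  show ?thesis
  proof (rule that)
    show "0 < c ^ k" "0 < 1 - real k * b" using c b by auto
    show "\<forall>\<^sub>F n in sequentially. c ^ k * real n powr (1 - real k * b) \<le> real n * g n ^ k"
      using ev eventually_ge_at_top[of 1]
    proof eventually_elim
      case (elim n)
      then have "(c * real n powr (- b)) ^ k \<le> g n ^ k" using c by (intro power_mono) auto
      then have "real n * (c * real n powr (- b)) ^ k \<le> real n * g n ^ k" by (intro mult_left_mono) auto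
      moreover have "real n * (c * real n powr (- b)) ^ k = c ^ k * real n powr (1 - real k * b)"
        using elim by (simp add: power_mult_distrib powr_power powr_diff powr_minus field_simps)
      ultimately show ?case by simp
    qed
  qed
qed

end

section \<open>Counting adapted events of the driving sequence\<close>

text \<open>The counterpart of measurability with respect to the first \<open>n\<close> members of the driving sequence. As these
take countably many values, measurability in the usual sense is automatic.\<close>

definition depends_on_first :: "nat \<Rightarrow> ((nat \<Rightarrow> nat) \<Rightarrow> 'b) \<Rightarrow> bool" where
  "depends_on_first n f \<longleftrightarrow> (\<forall>\<xi> \<xi>'. (\<forall>i\<in>{1..n}. \<xi> i = \<xi>' i) \<longrightarrow> f \<xi> = f \<xi>')"

lemma depends_on_firstD:
  "depends_on_first n f \<Longrightarrow> (\<And>i. 1 \<le> i \<Longrightarrow> i \<le> n \<Longrightarrow> \<xi> i = \<xi>' i) \<Longrightarrow> f \<xi> = f \<xi>'"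
  by (auto simp: depends_on_first_def)

lemma depends_on_first_compose2:
  assumes "depends_on_first n f" "depends_on_first n f'"
  shows "depends_on_first n (\<lambda>\<xi>. h (f \<xi>) (f' \<xi>))"
  using assms unfolding depends_on_first_def by metis

abbreviation driving :: "nat pmf \<Rightarrow> (nat \<Rightarrow> nat) measure" where
  "driving \<mu> \<equiv> PiM {1..} (\<lambda>_. measure_pmf \<mu>)"

interpretation driving: prob_space "driving \<mu>" for \<mu>
  by (intro prob_space_PiM measure_pmf.prob_space_axioms)

lemma measurable_driving_prefix:
  "(\<lambda>\<xi>. map \<xi> [1..<Suc n]) \<in> measurable (driving \<mu>) (count_space UNIV)"
proof (induction n)
  case (Suc n)
  have "(\<lambda>\<xi>. \<xi> (Suc n)) \<in> measurable (driving \<mu>) (measure_pmf \<mu>)"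
    by (rule measurable_component_singleton) simp
  then have "(\<lambda>\<xi>. \<xi> (Suc n)) \<in> measurable (driving \<mu>) (count_space UNIV)" by simp
  moreover have "(\<lambda>\<xi>. map \<xi> [1..<Suc n] @ [x]) \<in> measurable (driving \<mu>) (count_space UNIV)" for x
    using Suc by (rule measurable_compose) simp
  ultimately show ?case
    using measurable_compose_countable[where f = "\<lambda>x \<xi>. map \<xi> [1..<Suc n] @ [x]"
        and g = "\<lambda>\<xi>. \<xi> (Suc n)"] by simp
qed simp

lemma measurable_depends_on_first:
  assumes "depends_on_first n f" "space N = UNIV"
  shows "f \<in> measurable (driving \<mu>) N"
proof -
  define h where "h l = f (\<lambda>i. l ! (i - 1))" for l
  have "f \<xi> = h (map \<xi> [1..<Suc n])" for \<xi>
    unfolding h_def by (rule depends_on_firstD[OF assms(1)]) (auto simp: nth_map simp del: upt_Suc)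
  then have "f = (\<lambda>\<xi>. h (map \<xi> [1..<Suc n]))" by (rule ext)
  then show ?thesis
    using measurable_compose[OF measurable_driving_prefix, of h N n \<mu>] assms(2) by simp
qed

lemma pred_depends_on_first:
  "depends_on_first n P \<Longrightarrow> Measurable.pred (driving \<mu>) P"
  by (rule measurable_depends_on_first) auto

lemma sets_depends_on_first:
  assumes "depends_on_first n P"
  shows "{\<xi> \<in> space (driving \<mu>). P \<xi>} \<in> sets (driving \<mu>)"
  using pred_depends_on_first[OF assms] by (simp add: pred_def)

text \<open>The conditioning principle behind all estimates: given the past, the next value of the driving sequence has law
\<open>\<mu>\<close>. It is Fubini's theorem for the product of coordinate \<open>Suc n\<close> with all the others,
since replacing that coordinate does not affect \<open>f\<close>.\<close>

lemma nn_integral_driving_next: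
  fixes f :: "(nat \<Rightarrow> nat) \<Rightarrow> nat \<Rightarrow> ennreal"
  assumes dep: "depends_on_first n f"
  shows "(\<integral>\<^sup>+\<xi>. f \<xi> (\<xi> (Suc n)) \<partial>driving \<mu>) = (\<integral>\<^sup>+\<xi>. (\<integral>\<^sup>+x. f \<xi> x \<partial>measure_pmf \<mu>) \<partial>driving \<mu>)"
proof -
  define I where "I = {1..} - {Suc n}"
  have ins: "insert (Suc n) I = {1..}" by (auto simp: I_def)
  let ?Q = "PiM I (\<lambda>_. measure_pmf \<mu>)"
  interpret Q: prob_space ?Q by (intro prob_space_PiM measure_pmf.prob_space_axioms)
  interpret pair: pair_prob_space "measure_pmf \<mu>" ?Q ..
  let ?u = "\<lambda>(x, X). X(Suc n := x) :: nat \<Rightarrow> nat"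
  have u: "?u \<in> measurable (measure_pmf \<mu> \<Otimes>\<^sub>M ?Q) (driving \<mu>)"
    using measurable_add_dim[of "Suc n" I "\<lambda>_. measure_pmf \<mu>"]
    unfolding ins[symmetric] by (subst measurable_pair_swap_iff) (simp add: split_beta')
  have d: "distr (measure_pmf \<mu> \<Otimes>\<^sub>M ?Q) (driving \<mu>) ?u = driving \<mu>"
    using distr_pair_PiM_eq_PiM[of I "\<lambda>_. measure_pmf \<mu>" "Suc n"]
    unfolding ins by (simp add: measure_pmf.prob_space_axioms)
  have subst_u: "(\<integral>\<^sup>+\<xi>. h \<xi> \<partial>driving \<mu>) = (\<integral>\<^sup>+z. h (?u z) \<partial>(measure_pmf \<mu> \<Otimes>\<^sub>M ?Q))"
    if "h \<in> borel_measurable (driving \<mu>)" for h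
    using nn_integral_distr[OF u, of h] that unfolding d by simp
  have fX: "f (X(Suc n := x)) = f X" for X x
    by (rule depends_on_firstD[OF dep]) auto
  have m1: "(\<lambda>\<xi>. f \<xi> (\<xi> (Suc n))) \<in> borel_measurable (driving \<mu>)"
  proof (rule measurable_depends_on_first)
    have "f \<xi> = f \<xi>'" if "\<forall>i\<in>{1..Suc n}. \<xi> i = \<xi>' i" for \<xi> \<xi>'
      using that by (intro depends_on_firstD[OF dep]) auto
    then show "depends_on_first (Suc n) (\<lambda>\<xi>. f \<xi> (\<xi> (Suc n)))"
      unfolding depends_on_first_def by (metis atLeastAtMost_iff le_add1 order_refl plus_1_eq_Suc)
  qed simp
  have m2: "(\<lambda>\<xi>. \<integral>\<^sup>+x. f \<xi> x \<partial>measure_pmf \<mu>) \<in> borel_measurable (driving \<mu>)"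
    by (rule measurable_depends_on_first[of n])
       (use dep in \<open>auto simp: depends_on_first_def\<close>, metis)
  have m3: "(\<lambda>(x, X). f X x) \<in> borel_measurable (measure_pmf \<mu> \<Otimes>\<^sub>M ?Q)"
    using measurable_compose[OF u m1] by (simp add: split_beta' fX)
  have "(\<integral>\<^sup>+\<xi>. f \<xi> (\<xi> (Suc n)) \<partial>driving \<mu>) =
      (\<integral>\<^sup>+z. f (?u z) (?u z (Suc n)) \<partial>(measure_pmf \<mu> \<Otimes>\<^sub>M ?Q))"
    by (rule subst_u[OF m1])
  also have "\<dots> = (\<integral>\<^sup>+(x, X). f X x \<partial>(measure_pmf \<mu> \<Otimes>\<^sub>M ?Q))"
    by (intro nn_integral_cong) (auto simp: fX)
  also have "\<dots> = (\<integral>\<^sup>+X. (\<integral>\<^sup>+x. f X x \<partial>measure_pmf \<mu>) \<partial>?Q)"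
    using pair.nn_integral_snd[OF m3] by simp
  also have "\<dots> = (\<integral>\<^sup>+y. (\<integral>\<^sup>+X. (\<integral>\<^sup>+x. f X x \<partial>measure_pmf \<mu>) \<partial>?Q) \<partial>measure_pmf \<mu>)"
    by simp
  also have "\<dots> = (\<integral>\<^sup>+(y, X). (\<integral>\<^sup>+x. f X x \<partial>measure_pmf \<mu>) \<partial>(measure_pmf \<mu> \<Otimes>\<^sub>M ?Q))"
    using measurable_compose[OF u m2]
    by (subst Q.nn_integral_fst[symmetric]) (auto simp: split_beta' fX)
  also have "\<dots> = (\<integral>\<^sup>+z. (\<integral>\<^sup>+x. f (?u z) x \<partial>measure_pmf \<mu>) \<partial>(measure_pmf \<mu> \<Otimes>\<^sub>M ?Q))"
    by (intro nn_integral_cong) (auto simp: fX)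
  also have "\<dots> = (\<integral>\<^sup>+\<xi>. (\<integral>\<^sup>+x. f \<xi> x \<partial>measure_pmf \<mu>) \<partial>driving \<mu>)"
    by (rule subst_u[OF m2, symmetric])
  finally show ?thesis .
qed

text \<open>The set \<open>E n \<xi>\<close> is chosen after \<open>n\<close> steps; it is hit if the next value lies in it.\<close>

definition hits :: "(nat \<Rightarrow> (nat \<Rightarrow> nat) \<Rightarrow> nat set) \<Rightarrow> (nat \<Rightarrow> nat) \<Rightarrow> nat \<Rightarrow> nat \<Rightarrow> nat" where
  "hits E \<xi> N M = (\<Sum>n=N..<M. of_bool (\<xi> (Suc n) \<in> E n \<xi>))"

lemma hits_antimono: "N \<le> N' \<Longrightarrow> hits E \<xi> N' M \<le> hits E \<xi> N M"
  unfolding hits_def by (intro sum_mono2) auto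

lemma hits_Suc: "N \<le> M \<Longrightarrow> hits E \<xi> N (Suc M) = hits E \<xi> N M + of_bool (\<xi> (Suc M) \<in> E M \<xi>)"
  by (simp add: hits_def)

lemma depends_on_first_hits:
  assumes "\<And>n. depends_on_first n (E n)"
  shows "depends_on_first M (\<lambda>\<xi>. hits E \<xi> N M)"
  unfolding depends_on_first_def
proof (intro allI impI)
  fix \<xi> \<xi>' :: "nat \<Rightarrow> nat" assume eq: "\<forall>i\<in>{1..M}. \<xi> i = \<xi>' i"
  have "E n \<xi> = E n \<xi>'" if "n < M" for n
    using eq that by (intro depends_on_firstD[OF assms]) auto
  then show "hits E \<xi> N M = hits E \<xi>' N M"
    unfolding hits_def using eq by (intro sum.cong) auto
qed

lemma nn_integral_exp_of_bool:
  fixes \<mu> :: "nat pmf"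
  shows "(\<integral>\<^sup>+x. ennreal (exp (- of_bool (x \<in> A))) \<partial>measure_pmf \<mu>) \<le> ennreal (exp (- measure_pmf.prob \<mu> A / 2))"
proof -
  let ?r = "measure_pmf.prob \<mu> A"
  have "(\<integral>\<^sup>+x. ennreal (exp (- of_bool (x \<in> A))) \<partial>measure_pmf \<mu>) =
      (\<integral>\<^sup>+x. ennreal (exp (- 1)) * indicator A x + indicator (- A) x \<partial>measure_pmf \<mu>)"
    by (intro nn_integral_cong) (auto simp: indicator_def)
  also have "\<dots> = ennreal (exp (- 1)) * emeasure (measure_pmf \<mu>) A + emeasure (measure_pmf \<mu>) (- A)"
    by (simp add: nn_integral_add nn_integral_cmult)
  also have "\<dots> = ennreal (exp (- 1) * ?r + (1 - ?r))"
    using measure_pmf.prob_compl[of A \<mu>]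
    by (simp add: measure_pmf.emeasure_eq_measure ennreal_mult ennreal_plus Compl_eq_Diff_UNIV)
  also have "exp (- 1) * ?r + (1 - ?r) \<le> exp (- ?r / 2)"
  proof -
    have "exp (- 1) \<le> (1 / 2 :: real)"
      using exp_ge_add_one_self[of 1] by (simp add: exp_minus field_simps)
    then have "exp (- 1) * ?r \<le> 1 / 2 * ?r" by (rule mult_right_mono) simp
    then have "exp (- 1) * ?r + (1 - ?r) \<le> 1 + (- ?r / 2)" by simp
    also have "\<dots> \<le> exp (- ?r / 2)" by (rule exp_ge_add_one_self)
    finally show ?thesis .
  qed
  finally show ?thesis by (simp add: ennreal_leI)
qed

text \<open>A Chernoff bound for dependent events. On paths whose conditional hitting probabilities are at least \<open>p n\<close>,
each step multiplies the expectation of \<open>exp (- hits)\<close> by at most \<open>exp (- p n / 2)\<close>; Markov's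
inequality then bounds the probability of few hits. Cutting the weight to \<open>0\<close> when the conditional
probability is too small turns an almost sure lower bound on random rates into a hypothesis that can be used step by
step.\<close>

lemma few_hits_bound:
  fixes p :: "nat \<Rightarrow> real" and K :: real
  assumes E: "\<And>n. depends_on_first n (E n)" and NM: "N \<le> M"
  shows "emeasure (driving \<mu>) {\<xi> \<in> space (driving \<mu>).
      (\<forall>n\<in>{N..<M}. p n \<le> measure_pmf.prob \<mu> (E n \<xi>)) \<and> real (hits E \<xi> N M) \<le> K}
    \<le> ennreal (exp (K - (\<Sum>n=N..<M. p n) / 2))"
proof -
  define good where "good M \<xi> \<longleftrightarrow> (\<forall>n\<in>{N..<M}. p n \<le> measure_pmf.prob \<mu> (E n \<xi>))" for M \<xi>
  define W where "W M \<xi> = (if good M \<xi> then ennreal (exp (- real (hits E \<xi> N M))) else 0)" for M \<xi>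
  have good_dep: "depends_on_first M (good M)" for M
    unfolding depends_on_first_def
  proof (intro allI impI)
    fix \<xi> \<xi>' :: "nat \<Rightarrow> nat" assume eq: "\<forall>i\<in>{1..M}. \<xi> i = \<xi>' i"
    have "E n \<xi> = E n \<xi>'" if "n < M" for n
      using eq that by (intro depends_on_firstD[OF E]) auto
    then show "good M \<xi> = good M \<xi>'" by (auto simp: good_def)
  qed
  have W_dep: "depends_on_first M (W M)" for M
    unfolding W_def by (rule depends_on_first_compose2[OF good_dep depends_on_first_hits[OF E]])
  have bound: "(\<integral>\<^sup>+\<xi>. W M \<xi> \<partial>driving \<mu>) \<le> ennreal (exp (- (\<Sum>n=N..<M. p n) / 2))"
    using NM
  proof (induction M rule: dec_induct)
    case base
    have "(\<integral>\<^sup>+\<xi>. W N \<xi> \<partial>driving \<mu>) \<le> (\<integral>\<^sup>+\<xi>. 1 \<partial>driving \<mu>)"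
      by (intro nn_integral_mono) (auto simp: W_def)
    then show ?case by (simp add: driving.emeasure_space_1 del: One_nat_def)
  next
    case (step M)
    define f where "f \<xi> x = W M \<xi> * (if p M \<le> measure_pmf.prob \<mu> (E M \<xi>)
        then ennreal (exp (- of_bool (x \<in> E M \<xi>))) else 0)" for \<xi> and x :: nat
    have f_dep: "depends_on_first M f"
      unfolding f_def fun_eq_iff by (rule depends_on_first_compose2[OF W_dep E])
    have "W (Suc M) \<xi> = f \<xi> (\<xi> (Suc M))" for \<xi>
    proof -
      have "good (Suc M) \<xi> \<longleftrightarrow> good M \<xi> \<and> p M \<le> measure_pmf.prob \<mu> (E M \<xi>)"
        using step.hyps by (auto simp: good_def less_Suc_eq)
      moreover have "exp (- real (hits E \<xi> N (Suc M))) =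
          exp (- real (hits E \<xi> N M)) * exp (- of_bool (\<xi> (Suc M) \<in> E M \<xi>))"
        using step.hyps by (simp add: hits_Suc exp_add[symmetric])
      ultimately show ?thesis by (simp add: W_def f_def ennreal_mult)
    qed
    then have "(\<integral>\<^sup>+\<xi>. W (Suc M) \<xi> \<partial>driving \<mu>) = (\<integral>\<^sup>+\<xi>. (\<integral>\<^sup>+x. f \<xi> x \<partial>measure_pmf \<mu>) \<partial>driving \<mu>)"
      using nn_integral_driving_next[OF f_dep] by simp
    also have "\<dots> \<le> (\<integral>\<^sup>+\<xi>. W M \<xi> * ennreal (exp (- p M / 2)) \<partial>driving \<mu>)"
    proof (intro nn_integral_mono)
      fix \<xi>
      show "(\<integral>\<^sup>+x. f \<xi> x \<partial>measure_pmf \<mu>) \<le> W M \<xi> * ennreal (exp (- p M / 2))"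
      proof (cases "p M \<le> measure_pmf.prob \<mu> (E M \<xi>)")
        case True
        then have "(\<integral>\<^sup>+x. f \<xi> x \<partial>measure_pmf \<mu>) =
            W M \<xi> * (\<integral>\<^sup>+x. ennreal (exp (- of_bool (x \<in> E M \<xi>))) \<partial>measure_pmf \<mu>)"
          by (simp add: f_def nn_integral_cmult)
        also have "\<dots> \<le> W M \<xi> * ennreal (exp (- measure_pmf.prob \<mu> (E M \<xi>) / 2))"
          by (intro mult_left_mono nn_integral_exp_of_bool) simp
        also have "\<dots> \<le> W M \<xi> * ennreal (exp (- p M / 2))"
          using True by (intro mult_left_mono ennreal_leI) auto
        finally show ?thesis .
      qed (simp add: f_def)
    qed
    also have "\<dots> = (\<integral>\<^sup>+\<xi>. W M \<xi> \<partial>driving \<mu>) * ennreal (exp (- p M / 2))"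
      by (intro nn_integral_multc measurable_depends_on_first[OF W_dep]) simp
    also have "\<dots> \<le> ennreal (exp (- (\<Sum>n=N..<M. p n) / 2)) * ennreal (exp (- p M / 2))"
      using step.IH by (intro mult_right_mono) auto
    also have "\<dots> = ennreal (exp (- (\<Sum>n=N..<Suc M. p n) / 2))"
      using step.hyps by (simp add: ennreal_mult[symmetric] exp_add[symmetric] add_divide_distrib)
    finally show ?case .
  qed
  let ?A = "{\<xi> \<in> space (driving \<mu>). good M \<xi> \<and> real (hits E \<xi> N M) \<le> K}"
  have A: "?A \<in> sets (driving \<mu>)"
    by (intro sets_depends_on_first[of M] depends_on_first_compose2[OF good_dep depends_on_first_hits[OF E]])
  have "emeasure (driving \<mu>) ?A = (\<integral>\<^sup>+\<xi>. indicator ?A \<xi> \<partial>driving \<mu>)" using A by simp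
  also have "\<dots> \<le> (\<integral>\<^sup>+\<xi>. ennreal (exp K) * W M \<xi> \<partial>driving \<mu>)"
  proof (intro nn_integral_mono)
    fix \<xi>
    show "indicator ?A \<xi> \<le> ennreal (exp K) * W M \<xi>"
    proof (cases "\<xi> \<in> ?A")
      case True
      then have "ennreal (exp K) * W M \<xi> = ennreal (exp (K - real (hits E \<xi> N M)))"
        by (simp add: W_def ennreal_mult[symmetric] exp_add[symmetric])
      moreover have "1 \<le> exp (K - real (hits E \<xi> N M))" using True by simp
      ultimately show ?thesis using True ennreal_leI[of 1] by auto
    qed simp
  qed
  also have "\<dots> = ennreal (exp K) * (\<integral>\<^sup>+\<xi>. W M \<xi> \<partial>driving \<mu>)"
    by (intro nn_integral_cmult measurable_depends_on_first[OF W_dep]) simp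
  also have "\<dots> \<le> ennreal (exp K) * ennreal (exp (- (\<Sum>n=N..<M. p n) / 2))"
    by (intro mult_left_mono bound) simp
  also have "\<dots> = ennreal (exp (K - (\<Sum>n=N..<M. p n) / 2))"
    by (simp add: ennreal_mult[symmetric] exp_add[symmetric])
  finally show ?thesis by (simp add: good_def)
qed

text \<open>The conditional form of the second Borel-Cantelli lemma.\<close>

lemma AE_infinitely_many_hits:
  fixes p :: "nat \<Rightarrow> real"
  assumes E: "\<And>n. depends_on_first n (E n)"
    and rate: "AE \<xi> in driving \<mu>. \<forall>\<^sub>F n in sequentially. p n \<le> measure_pmf.prob \<mu> (E n \<xi>)"
    and p: "\<And>n. 0 \<le> p n" "\<not> summable p"
  shows "AE \<xi> in driving \<mu>. \<forall>K. \<exists>M. K < hits E \<xi> 0 M"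
proof -
  define A where "A N K M = {\<xi> \<in> space (driving \<mu>).
      (\<forall>n\<in>{N..<M}. p n \<le> measure_pmf.prob \<mu> (E n \<xi>)) \<and> real (hits E \<xi> N M) \<le> real K}"
    for N K M :: nat
  have A_dep: "depends_on_first M (\<lambda>\<xi>. (\<forall>n\<in>{N..<M}. p n \<le> measure_pmf.prob \<mu> (E n \<xi>)) \<and> real (hits E \<xi> N M) \<le> real K)" for N K M
    unfolding depends_on_first_def
  proof (intro allI impI)
    fix \<xi> \<xi>' :: "nat \<Rightarrow> nat" assume eq: "\<forall>i\<in>{1..M}. \<xi> i = \<xi>' i"
    have "E n \<xi> = E n \<xi>'" if "n < M" for n
      using eq that by (intro depends_on_firstD[OF E]) auto
    moreover have "hits E \<xi> N M = hits E \<xi>' N M"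
      using eq by (intro depends_on_firstD[OF depends_on_first_hits[OF E]]) auto
    ultimately show "((\<forall>n\<in>{N..<M}. p n \<le> measure_pmf.prob \<mu> (E n \<xi>)) \<and> real (hits E \<xi> N M) \<le> real K)
      = ((\<forall>n\<in>{N..<M}. p n \<le> measure_pmf.prob \<mu> (E n \<xi>')) \<and> real (hits E \<xi>' N M) \<le> real K)"
      by auto
  qed
  have A_sets: "A N K M \<in> sets (driving \<mu>)" for N K M
    unfolding A_def by (rule sets_depends_on_first[OF A_dep])
  have null: "(\<Inter>M\<in>{N..}. A N K M) \<in> null_sets (driving \<mu>)" for N K
  proof (rule null_setsI)
    show "(\<Inter>M\<in>{N..}. A N K M) \<in> sets (driving \<mu>)" 
      by (intro sets.countable_INT') (auto simp: A_sets simp del: One_nat_def)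
    show "emeasure (driving \<mu>) (\<Inter>M\<in>{N..}. A N K M) = 0"
    proof (rule ccontr)
      assume "emeasure (driving \<mu>) (\<Inter>M\<in>{N..}. A N K M) \<noteq> 0"
      then have pos: "measure (driving \<mu>) (\<Inter>M\<in>{N..}. A N K M) > 0"
        by (simp add: driving.emeasure_eq_measure zero_less_measure_iff del: One_nat_def)
      \<comment> \<open>A positive probability of having at most \<open>K\<close> hits forever bounds the partial sums of \<open>p\<close>.\<close>
      define e where "e = measure (driving \<mu>) (\<Inter>M\<in>{N..}. A N K M)"
      have le: "(\<Sum>n=N..<M. p n) \<le> 2 * (real K - ln e)" if M: "N \<le> M" for M
      proof -
        have "emeasure (driving \<mu>) (\<Inter>M\<in>{N..}. A N K M) \<le> emeasure (driving \<mu>) (A N K M)"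
          using M by (intro emeasure_mono A_sets) auto
        also have "\<dots> \<le> ennreal (exp (real K - (\<Sum>n=N..<M. p n) / 2))"
          unfolding A_def by (rule few_hits_bound[OF E M])
        finally have "e \<le> exp (real K - (\<Sum>n=N..<M. p n) / 2)"
          by (simp add: driving.emeasure_eq_measure e_def del: One_nat_def)
        then have "ln e \<le> real K - (\<Sum>n=N..<M. p n) / 2"
          using pos by (subst ln_exp[symmetric], intro ln_mono) (auto simp: e_def)
        then show ?thesis by simp
      qed
      have "summable (\<lambda>n. p (n + N))"
      proof (rule summableI_nonneg_bounded)
        fix M
        have "(\<Sum>n<M. p (n + N)) = (\<Sum>n=N..<N + M. p n)"
          using sum.shift_bounds_nat_ivl[of p 0 N M] by (simp add: lessThan_atLeast0 add.commute)
        then show "(\<Sum>n<M. p (n + N)) \<le> 2 * (real K - ln e)" using le[of "N + M"] by simp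
      qed (rule p(1))
      then show False using p(2) by (simp add: summable_iff_shift)
    qed
  qed
  have "AE \<xi> in driving \<mu>. \<forall>N K. \<xi> \<notin> (\<Inter>M\<in>{N..}. A N K M)"
    unfolding AE_all_countable by (intro allI AE_not_in null)
  with rate AE_space show ?thesis
  proof eventually_elim
    case (elim \<xi>)
    then obtain N where N: "\<And>n. n \<ge> N \<Longrightarrow> p n \<le> measure_pmf.prob \<mu> (E n \<xi>)"
      by (auto simp: eventually_sequentially)
    show ?case
    proof
      fix K
      from elim obtain M where M: "\<xi> \<notin> A N K M" by blast
      then have "K < hits E \<xi> N M" using elim N by (auto simp: A_def)
      then have "K < hits E \<xi> 0 M" using hits_antimono[of 0 N E \<xi> M] by simp
      then show "\<exists>M. K < hits E \<xi> 0 M" by blast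
    qed
  qed
qed

text \<open>Only the hits in the second half \<open>{M div 2..<M}\<close> are counted: there the lower bound on the rates, valid
from a random time on, holds throughout once \<open>M\<close> is large. If the exceptional probabilities are summable,
the first Borel-Cantelli lemma gives an almost sure bound for all large \<open>M\<close>.\<close>

lemma AE_eventually_many_hits:
  fixes p :: "nat \<Rightarrow> real"
  assumes E: "\<And>n. depends_on_first n (E n)"
    and rate: "AE \<xi> in driving \<mu>. \<forall>\<^sub>F n in sequentially. p n \<le> measure_pmf.prob \<mu> (E n \<xi>)"
    and sm: "summable (\<lambda>M. exp (- (\<Sum>n=M div 2..<M. p n) / 4))"
  shows "AE \<xi> in driving \<mu>. \<forall>\<^sub>F M in sequentially. (\<Sum>n=M div 2..<M. p n) / 4 < real (hits E \<xi> 0 M)"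
proof -
  define A where "A M = {\<xi> \<in> space (driving \<mu>). (\<forall>n\<in>{M div 2..<M}. p n \<le> measure_pmf.prob \<mu> (E n \<xi>)) \<and>
      real (hits E \<xi> (M div 2) M) \<le> (\<Sum>n=M div 2..<M. p n) / 4}" for M
  have A_sets: "A M \<in> sets (driving \<mu>)" for M
    unfolding A_def
  proof (rule sets_depends_on_first[of M], unfold depends_on_first_def, intro allI impI)
    fix \<xi> \<xi>' :: "nat \<Rightarrow> nat" assume eq: "\<forall>i\<in>{1..M}. \<xi> i = \<xi>' i"
    have "E n \<xi> = E n \<xi>'" if "n < M" for n
      using eq that by (intro depends_on_firstD[OF E]) auto
    moreover have "hits E \<xi> (M div 2) M = hits E \<xi>' (M div 2) M"
      using eq by (intro depends_on_firstD[OF depends_on_first_hits[OF E]]) auto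
    ultimately show "((\<forall>n\<in>{M div 2..<M}. p n \<le> measure_pmf.prob \<mu> (E n \<xi>)) \<and> real (hits E \<xi> (M div 2) M) \<le> (\<Sum>n=M div 2..<M. p n) / 4)
      = ((\<forall>n\<in>{M div 2..<M}. p n \<le> measure_pmf.prob \<mu> (E n \<xi>')) \<and> real (hits E \<xi>' (M div 2) M) \<le> (\<Sum>n=M div 2..<M. p n) / 4)"
      by auto
  qed
  have "measure (driving \<mu>) (A M) \<le> exp (- (\<Sum>n=M div 2..<M. p n) / 4)" for M
  proof -
    have "emeasure (driving \<mu>) (A M) \<le> ennreal (exp ((\<Sum>n=M div 2..<M. p n) / 4 - (\<Sum>n=M div 2..<M. p n) / 2))"
      unfolding A_def by (rule few_hits_bound[OF E]) simp
    then show ?thesis by (simp add: driving.emeasure_eq_measure del: One_nat_def)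
  qed
  then have "summable (\<lambda>M. measure (driving \<mu>) (A M))"
    by (intro summable_comparison_test'[OF sm]) auto
  then have "AE \<xi> in driving \<mu>. \<forall>\<^sub>F M in sequentially. \<xi> \<in> space (driving \<mu>) - A M"
    by (intro borel_cantelli_AE1 A_sets) (auto simp: driving.emeasure_eq_measure simp del: One_nat_def)
  with rate show ?thesis
  proof eventually_elim
    case (elim \<xi>)
    then obtain N where N: "\<And>n. n \<ge> N \<Longrightarrow> p n \<le> measure_pmf.prob \<mu> (E n \<xi>)"
      by (auto simp: eventually_sequentially)
    show ?case using elim(2) eventually_ge_at_top[of "2 * N"]
    proof eventually_elim
      case (elim M)
      then have "n \<ge> N" if "n \<ge> M div 2" for n using that by linarith
      then have "(\<Sum>n=M div 2..<M. p n) / 4 < real (hits E \<xi> (M div 2) M)"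
        using elim N by (auto simp: A_def)
      also have "\<dots> \<le> real (hits E \<xi> 0 M)" by (intro of_nat_mono hits_antimono) simp
      finally show ?case .
    qed
  qed
qed

section \<open>The bins of the model\<close>

text \<open>The number of balls at positions \<open>\<ge> k\<close> after \<open>n\<close> steps, meaningful for
\<open>k \<ge> 1\<close>. The value at \<open>k = 0\<close>, where there are infinitely many balls, is set to that at
\<open>k = 1\<close>, which keeps the sequence monotone in \<open>k\<close> without leaving the natural numbers.\<close>

primrec balls :: "(nat \<Rightarrow> nat) \<Rightarrow> nat \<Rightarrow> nat \<Rightarrow> nat" where
  "balls \<xi> 0 = (\<lambda>k. 0)"
| "balls \<xi> (Suc n) = (\<lambda>k. balls \<xi> n k + of_bool (k \<le> 1 \<or> \<xi> (Suc n) \<le> balls \<xi> n (k - 1)))"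

text \<open>The values of the next draw that put the new ball into bin \<open>k\<close>, for \<open>k \<ge> 1\<close>.\<close>

definition fill :: "nat \<Rightarrow> nat \<Rightarrow> (nat \<Rightarrow> nat) \<Rightarrow> nat set" where
  "fill k n \<xi> = {x. balls \<xi> n k < x \<and> (k \<le> 1 \<or> x \<le> balls \<xi> n (k - 1))}"

lemma balls_first: "k \<le> 1 \<Longrightarrow> balls \<xi> n k = n"
  by (induction n) auto

lemma balls_Suc_le: "balls \<xi> n (Suc k) \<le> balls \<xi> n k"
proof (induction n arbitrary: k)
  case (Suc n)
  show ?case
  proof (cases "k \<le> 1")
    case True
    then show ?thesis using Suc[of k] balls_first[of _ \<xi> n] by auto
  next
    case False
    then have "balls \<xi> n k \<le> balls \<xi> n (k - 1)" using Suc[of "k - 1"] by simp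
    then show ?thesis using Suc[of k] False by auto
  qed
qed simp

lemma balls_antimono: "k \<le> l \<Longrightarrow> balls \<xi> n l \<le> balls \<xi> n k"
  by (rule lift_Suc_antimono_le[of "balls \<xi> n"]) (rule balls_Suc_le)

lemma balls_le: "balls \<xi> n k \<le> n"
  using balls_antimono[of 0 k \<xi> n] balls_first[of 0 \<xi> n] by simp

lemma balls_eq_0:
  assumes "\<forall>i\<ge>1. 1 \<le> \<xi> i" "n < k"
  shows "balls \<xi> n k = 0"
  using assms(2)
proof (induction n arbitrary: k)
  case (Suc n)
  have "balls \<xi> n k = 0" "balls \<xi> n (k - 1) = 0" using Suc by auto
  moreover have "1 \<le> \<xi> (Suc n)" using assms(1) by simp
  ultimately show ?case using Suc.prems by auto
qed simp

lemma balls_eq_add_hits: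
  assumes "1 \<le> k"
  shows "balls \<xi> n k = balls \<xi> n (Suc k) + hits (fill k) \<xi> 0 n"
proof (induction n)
  case (Suc n)
  have "balls \<xi> n k \<le> balls \<xi> n (k - 1)" by (rule balls_antimono) simp
  then show ?case using Suc assms by (auto simp: hits_Suc fill_def)
qed (simp add: hits_def)

text \<open>A draw of \<open>1\<close> puts the new ball immediately to the right of the rightmost one. So it adds a ball to
\<open>{k..}\<close>, except while the front has not reached \<open>k - 1\<close>, which can happen for at most
\<open>k - 1\<close> such draws.\<close>

lemma hits_one_le_balls: "hits (\<lambda>_ _. {1}) \<xi> 0 n \<le> balls \<xi> n k + (k - 1)"
proof (induction n arbitrary: k)
  case (Suc n)
  show ?case
  proof (cases "k \<le> 1")
    case True
    then show ?thesis using Suc[of k] by (simp add: hits_Suc)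
  next
    case False
    show ?thesis using Suc[of k] Suc[of "k - 1"] False
      by (cases "balls \<xi> n (k - 1) = 0") (auto simp: hits_Suc)
  qed
qed (simp add: hits_def)

lemma depends_on_first_balls: "depends_on_first n (\<lambda>\<xi>. balls \<xi> n k)"
  unfolding depends_on_first_def
proof (intro allI impI)
  fix \<xi> \<xi>' :: "nat \<Rightarrow> nat" assume "\<forall>i\<in>{1..n}. \<xi> i = \<xi>' i"
  then show "balls \<xi> n k = balls \<xi>' n k"
    by (induction n arbitrary: k) auto
qed

lemma depends_on_first_fill: "depends_on_first n (fill k n)"
  unfolding fill_def[abs_def]
  by (rule depends_on_first_compose2[OF depends_on_first_balls depends_on_first_balls])

definition bin_config :: "(nat \<Rightarrow> nat) \<Rightarrow> nat \<Rightarrow> configuration" where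
  "bin_config \<xi> n j = (if j = 0 then \<infinity> else if j < 0 then 0 else enat (hits (fill (nat j)) \<xi> 0 n))"

lemma sum_bin_config_right:
  assumes \<xi>: "\<forall>i\<ge>1. 1 \<le> \<xi> i"
  shows "(\<Sum>\<^sub>\<infinity>i\<in>{j..}. bin_config \<xi> n i) = (if j \<le> 0 then \<infinity> else enat (balls \<xi> n (nat j)))"
proof -
  have zero: "bin_config \<xi> n i = 0" if "int n < i" for i
    using balls_eq_add_hits[of "nat i" \<xi> n] balls_eq_0[OF \<xi>, of n "nat i"] that
    by (simp add: bin_config_def zero_enat_def)
  have fin: "(\<Sum>\<^sub>\<infinity>i\<in>{j..}. bin_config \<xi> n i) = (\<Sum>i=j..int n. bin_config \<xi> n i)"
  proof -
    have "(\<Sum>\<^sub>\<infinity>i\<in>{j..}. bin_config \<xi> n i) = (\<Sum>\<^sub>\<infinity>i\<in>{j..int n}. bin_config \<xi> n i)"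
      by (rule infsum_cong_neutral) (auto simp: zero)
    then show ?thesis by simp
  qed
  show ?thesis
  proof (cases "j \<le> 0")
    case True
    have "(\<Sum>i=j..int n. bin_config \<xi> n i) = bin_config \<xi> n 0 + (\<Sum>i\<in>{j..int n} - {0}. bin_config \<xi> n i)"
      using True by (intro sum.remove) auto
    then show ?thesis using fin True by (simp add: bin_config_def)
  next
    case False
    have "(\<Sum>i=int k..int n. bin_config \<xi> n i) = enat (balls \<xi> n k)" if "k \<le> Suc n" "1 \<le> k" for k
      using that
    proof (induction k rule: inc_induct)
      case base
      then show ?case using balls_eq_0[OF \<xi>, of n "Suc n"] by (simp add: zero_enat_def)
    next
      case (step k)
      have "{int k..int n} = insert (int k) {int (Suc k)..int n}" using step.hyps by auto
      then have "(\<Sum>i=int k..int n. bin_config \<xi> n i) = bin_config \<xi> n (int k) + enat (balls \<xi> n (Suc k))"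
        using step.IH by simp
      then show ?case
        using balls_eq_add_hits[of k \<xi> n] step.prems by (simp add: bin_config_def)
    qed
    from this[of "nat j"] show ?thesis using fin False zero[of j] balls_eq_0[OF \<xi>, of n "nat j"]
      by (cases "nat j \<le> Suc n") (auto simp: zero_enat_def)
  qed
qed

text \<open>The rightmost positions with at least \<open>\<xi> (Suc n)\<close> balls weakly to their right form a half-line
\<open>{..J}\<close> with \<open>J \<ge> 0\<close>, and the draw lies in the filling set of bin \<open>k\<close> exactly
if \<open>k = Suc J\<close>.\<close>

lemma move_bin_config:
  assumes \<xi>: "\<forall>i\<ge>1. 1 \<le> \<xi> i"
  shows "move (\<xi> (Suc n)) (bin_config \<xi> n) = bin_config \<xi> (Suc n)"
proof -
  let ?x = "\<xi> (Suc n)"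
  have x: "1 \<le> ?x" using \<xi> by simp
  define P where "P i \<longleftrightarrow> i = 0 \<or> ?x \<le> balls \<xi> n i" for i
  define J where "J = (GREATEST i. P i)"
  have Pb: "i \<le> n" if "P i" for i
    using that balls_eq_0[OF \<xi>, of n i] x by (cases "i \<le> n") (auto simp: P_def)
  have "P 0" by (simp add: P_def)
  then have PJ: "P J" unfolding J_def using Pb by (rule GreatestI_nat)
  have J: "i \<le> J \<longleftrightarrow> ?x \<le> balls \<xi> n i" if "1 \<le> i" for i
  proof
    assume "i \<le> J"
    then show "?x \<le> balls \<xi> n i"
      using PJ balls_antimono[of i J \<xi> n] that by (auto simp: P_def)
  next
    assume "?x \<le> balls \<xi> n i"
    then show "i \<le> J" unfolding J_def using Pb by (intro Greatest_le_nat) (auto simp: P_def)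
  qed
  have "{j. enat ?x \<le> (\<Sum>\<^sub>\<infinity>i\<in>{j..}. bin_config \<xi> n i)} = {..int J}"
  proof (intro set_eqI)
    fix j
    show "j \<in> {j. enat ?x \<le> (\<Sum>\<^sub>\<infinity>i\<in>{j..}. bin_config \<xi> n i)} \<longleftrightarrow> j \<in> {..int J}"
      using J[of "nat j"] unfolding mem_Collect_eq sum_bin_config_right[OF \<xi>]
      by (cases "j \<le> 0") (auto simp: nat_le_iff)
  qed
  then have "ball_pos (bin_config \<xi> n) ?x = (SUP j\<in>{..int J}. ereal (of_int j))"
    by (simp add: ball_pos_def)
  also have "\<dots> = ereal (real J)"
    by (rule antisym[OF SUP_least SUP_upper2[of "int J"]]) auto
  finally have bp: "ball_pos (bin_config \<xi> n) ?x = ereal (real J)" .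
  have fillJ: "?x \<in> fill k n \<xi> \<longleftrightarrow> k = Suc J" if "1 \<le> k" for k
    using J[of k] J[of "k - 1"] that by (cases k; cases "k - 1") (auto simp: fill_def)
  show ?thesis
  proof
    fix j
    have "ereal (of_int j) = ball_pos (bin_config \<xi> n) ?x + 1 \<longleftrightarrow> j = int (Suc J)"
      unfolding bp by (simp add: one_ereal_def) linarith
    then have "move ?x (bin_config \<xi> n) j = bin_config \<xi> n j + of_bool (j = int (Suc J))"
      by (simp add: move_def bp)
    also have "\<dots> = bin_config \<xi> (Suc n) j"
      using fillJ[of "nat j"] by (auto simp: bin_config_def hits_Suc one_enat_def)
    finally show "move ?x (bin_config \<xi> n) j = bin_config \<xi> (Suc n) j" .
  qed
qed

lemma ibm_hat_config:
  assumes "\<forall>i\<ge>1. 1 \<le> \<xi> i"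
  shows "ibm hat_config \<xi> n = bin_config \<xi> n"
proof (induction n)
  case 0
  show ?case by (auto simp: fun_eq_iff hat_config_def bin_config_def hits_def zero_enat_def)
next
  case (Suc n)
  then show ?case using move_bin_config[OF assms] by simp
qed

lemma ibm_limit_hat_finite_iff:
  assumes "\<forall>i\<ge>1. 1 \<le> \<xi> i" "1 \<le> k"
  shows "ibm_limit hat_config \<xi> (int k) < \<infinity> \<longleftrightarrow> (\<exists>m. \<forall>n. hits (fill k) \<xi> 0 n \<le> m)"
  unfolding ibm_limit_finite_iff ibm_hat_config[OF assms(1)]
  using assms(2) by (simp add: bin_config_def)

lemma depends_on_first_const: "depends_on_first n (\<lambda>_. c)"
  by (simp add: depends_on_first_def)

text \<open>The draws equal to \<open>1\<close> have a positive frequency, and all but \<open>k - 1\<close> of them add a ball to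
\<open>{k..}\<close>. The constant is half of the rate \<open>pmf \<mu> 1 / 8\<close> that the counting lemma yields, to
make room for these exceptions.\<close>

lemma AE_balls_linear:
  assumes "0 < pmf \<mu> 1"
  shows "AE \<xi> in driving \<mu>. \<forall>k. \<forall>\<^sub>F n in sequentially. pmf \<mu> 1 / 16 * real n \<le> real (balls \<xi> n k)"
proof -
  define q where "q = pmf \<mu> 1"
  have q: "q > 0" using assms by (simp add: q_def)
  have half: "q / 8 * real M \<le> (\<Sum>n=M div 2..<M. q) / 4" for M
  proof -
    have "real M / 2 \<le> real (M - M div 2)" by linarith
    then have "q * (real M / 2) \<le> q * real (M - M div 2)" using q by (intro mult_left_mono) auto
    then show ?thesis by (simp add: mult.commute)
  qed
  have "AE \<xi> in driving \<mu>. \<forall>\<^sub>F M in sequentially. (\<Sum>n=M div 2..<M. q) / 4 < real (hits (\<lambda>_ _. {1}) \<xi> 0 M)"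
  proof (rule AE_eventually_many_hits)
    show "depends_on_first n (\<lambda>_. {1})" for n by (rule depends_on_first_const)
    show "AE \<xi> in driving \<mu>. \<forall>\<^sub>F n in sequentially. q \<le> measure_pmf.prob \<mu> {1}"
      by (simp add: q_def measure_pmf_single)
    show "summable (\<lambda>M. exp (- (\<Sum>n=M div 2..<M. q) / 4))"
    proof (rule summable_comparison_test')
      show "summable (\<lambda>M. exp (- q / 8) ^ M)" using q by (intro summable_geometric) auto
      show "norm (exp (- (\<Sum>n=M div 2..<M. q) / 4)) \<le> exp (- q / 8) ^ M" for M
        using half[of M] by (simp add: exp_of_nat_mult[symmetric] mult.commute)
    qed
  qed
  then show ?thesis
  proof eventually_elim
    case (elim \<xi>)
    show ?case
    proof
      fix k
      have "\<forall>\<^sub>F n in sequentially. real k \<le> q / 16 * real n"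
        using q by real_asymp
      with elim show "\<forall>\<^sub>F n in sequentially. pmf \<mu> 1 / 16 * real n \<le> real (balls \<xi> n k)"
      proof eventually_elim
        case (elim n)
        have "real (hits (\<lambda>_ _. {1}) \<xi> 0 n) \<le> real (balls \<xi> n k + (k - 1))"
          by (intro of_nat_mono hits_one_le_balls)
        then have "q / 8 * real n \<le> real (balls \<xi> n k) + real k"
          using elim half[of n] by linarith
        moreover have "q / 8 * real n = q / 16 * real n + q / 16 * real n" by simp
        ultimately show ?case using elim unfolding q_def[symmetric] by linarith
      qed
    qed
  qed
qed

section \<open>Which bins fill up\<close>

text \<open>Makes the exceptional probabilities summable in the growth estimate for the bins.\<close>

lemma summable_exp_powr:
  fixes c e :: real
  assumes "0 < c" "0 < e"
  shows "summable (\<lambda>n. exp (- (c * real n powr e)))"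
proof (rule summable_comparison_test_ev)
  show "summable (\<lambda>n. real n powr (- 2))" by (simp only: summable_real_powr_iff)
  have "\<forall>\<^sub>F n in sequentially. exp (- (c * real n powr e)) \<le> real n powr (- 2)"
    using assms by real_asymp
  then show "\<forall>\<^sub>F n in sequentially. norm (exp (- (c * real n powr e))) \<le> real n powr (- 2)" by simp
qed

lemma suminf_of_bool_ge_hits:
  assumes "\<And>n. N \<le> n \<Longrightarrow> P n"
  shows "of_nat (hits E \<xi> N M) \<le> (\<Sum>n. of_bool (N \<le> n \<and> P n \<and> \<xi> (Suc n) \<in> E n \<xi>) :: ennreal)"
proof -
  have "of_nat (hits E \<xi> N M) = (\<Sum>n=N..<M. of_bool (N \<le> n \<and> P n \<and> \<xi> (Suc n) \<in> E n \<xi>) :: ennreal)"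
    using assms by (auto simp: hits_def intro!: sum.cong)
  also have "\<dots> \<le> (\<Sum>n. of_bool (N \<le> n \<and> P n \<and> \<xi> (Suc n) \<in> E n \<xi>))"
    by (intro sum_le_suminf) auto
  finally show ?thesis .
qed

lemma hits_le_split: "hits E \<xi> 0 n \<le> N + hits E \<xi> N n"
proof (cases "N \<le> n")
  case True
  then have "hits E \<xi> 0 n = hits E \<xi> 0 N + hits E \<xi> N n"
    unfolding hits_def by (intro sum.atLeastLessThan_concat[symmetric]) auto
  moreover have "hits E \<xi> 0 N \<le> (\<Sum>n=0..<N. 1)" unfolding hits_def by (intro sum_mono) auto
  ultimately show ?thesis by simp
next
  case False
  have "hits E \<xi> 0 n \<le> (\<Sum>n=0..<n. 1)" unfolding hits_def by (intro sum_mono) auto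
  then show ?thesis using False by simp
qed

lemma prob_fill_1: "measure_pmf.prob \<mu> (fill (Suc 0) n \<xi>) = tail \<mu> (Suc n)"
proof -
  have "fill (Suc 0) n \<xi> = {Suc n..}" by (auto simp: fill_def balls_first)
  then show ?thesis by (simp add: tail_def)
qed

context regularly_varying_law
begin

definition \<delta> :: real where "\<delta> = pmf \<mu> 1 / 16"

lemma \<delta>_pos: "0 < \<delta>"
  using pmf_pos[of 1] by (simp add: \<delta>_def)

lemma AE_balls_ge: "AE \<xi> in driving \<mu>. \<forall>k. \<forall>\<^sub>F n in sequentially. \<delta> * real n \<le> real (balls \<xi> n k)"
  unfolding \<delta>_def by (rule AE_balls_linear) (simp add: pmf_pos)

text \<open>The filling set of bin \<open>k + 1\<close> consists of as many values as there are balls in bin \<open>k\<close>. They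
lie between \<open>\<delta> * n\<close> and \<open>n\<close>, so each of them has mass comparable to
\<open>pmf \<mu> n\<close>.\<close>

lemma prob_fill_comparable:
  obtains C where "1 \<le> C"
    "\<And>k n \<xi>. 1 \<le> k \<Longrightarrow> \<delta> * real n \<le> real (balls \<xi> n (Suc k)) \<Longrightarrow>
      comparable C (measure_pmf.prob \<mu> (fill (Suc k) n \<xi>)) (real (hits (fill k) \<xi> 0 n) * pmf \<mu> n)"
proof -
  obtain C where C: "1 \<le> C"
    and cmp: "\<And>n j. 1 \<le> j \<Longrightarrow> \<delta> * real n \<le> real j \<Longrightarrow> j \<le> n \<Longrightarrow> comparable C (pmf \<mu> j) (pmf \<mu> n)"
    using regularly_varying_comparable[OF regularly_varying_pmf \<delta>_pos] by metis
  show ?thesis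
  proof (rule that[OF C])
    fix k n \<xi> assume k: "1 \<le> k" and ge: "\<delta> * real n \<le> real (balls \<xi> n (Suc k))"
    let ?I = "{balls \<xi> n (Suc k)<..balls \<xi> n k}"
    have "fill (Suc k) n \<xi> = ?I" using k by (auto simp: fill_def)
    then have p: "measure_pmf.prob \<mu> (fill (Suc k) n \<xi>) = (\<Sum>j\<in>?I. pmf \<mu> j)"
      by (simp add: measure_measure_pmf_finite)
    have c: "real (hits (fill k) \<xi> 0 n) = real (card ?I)"
      using balls_eq_add_hits[OF k, of \<xi> n] by simp
    have j: "comparable C (pmf \<mu> j) (pmf \<mu> n)" if "j \<in> ?I" for j
      using that ge balls_le[of \<xi> n k] by (intro cmp) auto
    have "(\<Sum>j\<in>?I. pmf \<mu> j) \<le> (\<Sum>j\<in>?I. C * pmf \<mu> n)"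
      using j by (intro sum_mono) (auto simp: comparable_def)
    moreover have "(\<Sum>j\<in>?I. pmf \<mu> n) \<le> (\<Sum>j\<in>?I. C * pmf \<mu> j)"
      using j by (intro sum_mono) (auto simp: comparable_def)
    ultimately show "comparable C (measure_pmf.prob \<mu> (fill (Suc k) n \<xi>)) (real (hits (fill k) \<xi> 0 n) * pmf \<mu> n)"
      unfolding comparable_def p c by (simp add: sum_distrib_left[symmetric] mult_ac)
  qed
qed

text \<open>Induction on \<open>k\<close>: the rate bound for bin \<open>k\<close> and the counting lemma give at least a constant
times \<open>n * g n ^ k\<close> balls in bin \<open>k\<close>, and by comparability bin \<open>k + 1\<close> is then
hit at a rate at least a constant times \<open>n * g n ^ k * pmf \<mu> n = g n ^ (k + 1)\<close>.\<close>

lemma AE_fill_rate_ge: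
  assumes div: "\<not> summable (\<lambda>n. g n ^ h)" and k: "1 \<le> k" "k \<le> h"
  shows "\<exists>c>0. AE \<xi> in driving \<mu>. \<forall>\<^sub>F n in sequentially. c * g n ^ k \<le> measure_pmf.prob \<mu> (fill k n \<xi>)"
  using k(1) k(2)
proof (induction k rule: dec_induct)
  case base
  obtain c where c: "0 < c" "\<And>n. 1 \<le> n \<Longrightarrow> c * g n \<le> tail \<mu> (Suc n)" using tail_ge_g by metis
  have "\<forall>\<^sub>F n in sequentially. c * g n ^ 1 \<le> measure_pmf.prob \<mu> (fill 1 n \<xi>)" for \<xi>
    using eventually_ge_at_top[of 1] by eventually_elim (simp add: prob_fill_1 c)
  with c(1) show ?case by blast
next
  case (step k)
  then obtain c where c: "c > 0"
    and rate: "AE \<xi> in driving \<mu>. \<forall>\<^sub>F n in sequentially. c * g n ^ k \<le> measure_pmf.prob \<mu> (fill k n \<xi>)"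
    by auto
  obtain c1 e where c1: "0 < c1" "0 < e" and ev: "\<forall>\<^sub>F n in sequentially. c1 * real n powr e \<le> real n * g n ^ k"
    using n_g_power_lower_powr[OF div, of k] step.prems by auto
  obtain D where D: "1 \<le> D"
    and cmp: "\<And>n j. 1 \<le> j \<Longrightarrow> 1 / 4 * real n \<le> real j \<Longrightarrow> j \<le> n \<Longrightarrow> comparable D (pmf \<mu> j) (pmf \<mu> n)"
    using regularly_varying_comparable[OF regularly_varying_pmf, of "1 / 4"] by auto
  \<comment> \<open>There are at least \<open>M / 2\<close> times \<open>n\<close> in \<open>{M div 2..<M}\<close>, for each of them \<open>g n \<ge> g M / (4 * D)\<close>, and
    the counting lemma keeps a quarter of the sum of the rates.\<close>
  define c2 where "c2 = c / (8 * (4 * D) ^ k)"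
  have c2: "c2 > 0" using c D by (simp add: c2_def)
  have block: "c2 * (real M * g M ^ k) \<le> (\<Sum>n=M div 2..<M. c * g n ^ k) / 4" if M: "2 \<le> M" for M
  proof -
    have "c * (g M / (4 * D)) ^ k \<le> c * g n ^ k" if n: "n \<in> {M div 2..<M}" for n
    proof -
      have "M \<le> 4 * n" "1 \<le> n" using n M by auto
      then have nM: "1 / 4 * real M \<le> real n" by linarith
      then have "pmf \<mu> M \<le> D * pmf \<mu> n" using cmp[of n M] n \<open>1 \<le> n\<close> by (auto simp: comparable_def)
      then have "1 / 4 * real M * pmf \<mu> M \<le> real n * (D * pmf \<mu> n)"
        using nM by (intro mult_mono) auto
      then have "g M / (4 * D) \<le> g n" using D by (simp add: g_def field_simps)
      then show ?thesis using c D g_nonneg[of M] by (intro mult_left_mono power_mono) auto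
    qed
    then have le: "(\<Sum>n=M div 2..<M. c * (g M / (4 * D)) ^ k) \<le> (\<Sum>n=M div 2..<M. c * g n ^ k)"
      by (intro sum_mono)
    have "real M / 2 * (c * (g M / (4 * D)) ^ k) \<le> real (M - M div 2) * (c * (g M / (4 * D)) ^ k)"
    proof (rule mult_right_mono)
      show "real M / 2 \<le> real (M - M div 2)" by linarith
      show "0 \<le> c * (g M / (4 * D)) ^ k" using c D g_nonneg[of M] by simp
    qed
    moreover have "c2 * (real M * g M ^ k) = real M / 2 * (c * (g M / (4 * D)) ^ k) / 4"
      by (simp add: c2_def power_divide)
    ultimately have "c2 * (real M * g M ^ k) \<le> (\<Sum>n=M div 2..<M. c * (g M / (4 * D)) ^ k) / 4"
      by (simp only: sum_constant card_atLeastLessThan divide_right_mono)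
    also have "\<dots> \<le> (\<Sum>n=M div 2..<M. c * g n ^ k) / 4"
      using le by (rule divide_right_mono) simp
    finally show ?thesis .
  qed
  have hits: "AE \<xi> in driving \<mu>. \<forall>\<^sub>F M in sequentially. (\<Sum>n=M div 2..<M. c * g n ^ k) / 4 < real (hits (fill k) \<xi> 0 M)"
  proof (rule AE_eventually_many_hits[OF depends_on_first_fill rate])
    show "summable (\<lambda>M. exp (- (\<Sum>n=M div 2..<M. c * g n ^ k) / 4))"
    proof (rule summable_comparison_test_ev)
      show "summable (\<lambda>n. exp (- (c2 * c1 * real n powr e)))"
        using c1 c2 by (intro summable_exp_powr) auto
      show "\<forall>\<^sub>F M in sequentially. norm (exp (- (\<Sum>n=M div 2..<M. c * g n ^ k) / 4)) \<le> exp (- (c2 * c1 * real M powr e))"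
        using ev eventually_ge_at_top[of 2]
      proof eventually_elim
        case (elim M)
        then have "c2 * (c1 * real M powr e) \<le> c2 * (real M * g M ^ k)" using c2 by (intro mult_left_mono) auto
        with block[of M] elim show ?case by (simp add: mult_ac)
      qed
    qed
  qed
  obtain C where C: "1 \<le> C"
    and pf: "\<And>k n \<xi>. 1 \<le> k \<Longrightarrow> \<delta> * real n \<le> real (balls \<xi> n (Suc k)) \<Longrightarrow>
      comparable C (measure_pmf.prob \<mu> (fill (Suc k) n \<xi>)) (real (hits (fill k) \<xi> 0 n) * pmf \<mu> n)"
    using prob_fill_comparable by metis
  have "AE \<xi> in driving \<mu>. \<forall>\<^sub>F n in sequentially. c2 / C * g n ^ Suc k \<le> measure_pmf.prob \<mu> (fill (Suc k) n \<xi>)"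
    using hits AE_balls_ge
  proof eventually_elim
    case (elim \<xi>)
    from elim(2) have "\<forall>\<^sub>F n in sequentially. \<delta> * real n \<le> real (balls \<xi> n (Suc k))" ..
    with elim(1) show ?case using eventually_ge_at_top[of 2]
    proof eventually_elim
      case (elim n)
      have "c2 * (real n * g n ^ k) \<le> real (hits (fill k) \<xi> 0 n)" using elim block[of n] by linarith
      then have "c2 * (real n * g n ^ k) * pmf \<mu> n \<le> real (hits (fill k) \<xi> 0 n) * pmf \<mu> n"
        by (intro mult_right_mono) auto
      also have "\<dots> \<le> C * measure_pmf.prob \<mu> (fill (Suc k) n \<xi>)"
        using pf[of k n \<xi>] elim step.hyps by (auto simp: comparable_def)
      finally show ?case using C by (simp add: g_def field_simps)
    qed
  qed
  moreover have "c2 / C > 0" using c2 C by simp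
  ultimately show ?case by blast
qed

lemma AE_bin_infinite:
  assumes "1 \<le> h" "\<not> summable (\<lambda>n. tail \<mu> n ^ h)"
  shows "AE \<xi> in driving \<mu>. \<not> (\<exists>m. \<forall>n. hits (fill h) \<xi> 0 n \<le> m)"
proof -
  have div: "\<not> summable (\<lambda>n. g n ^ h)" using assms summable_tail_power_iff by simp
  then obtain c where c: "c > 0"
    and rate: "AE \<xi> in driving \<mu>. \<forall>\<^sub>F n in sequentially. c * g n ^ h \<le> measure_pmf.prob \<mu> (fill h n \<xi>)"
    using AE_fill_rate_ge[OF div assms(1)] by auto
  have "\<not> summable (\<lambda>n. c * g n ^ h)" using div c by (subst summable_cmult_iff) auto
  then have "AE \<xi> in driving \<mu>. \<forall>K. \<exists>M. K < hits (fill h) \<xi> 0 M"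
    using c g_nonneg by (intro AE_infinitely_many_hits[OF depends_on_first_fill rate]) auto
  then show ?thesis by eventually_elim (auto simp: not_le)
qed

text \<open>The events are restricted to paths on which the linear lower bound has held from time \<open>N\<close> up to the
present; almost every path satisfies this forever for some \<open>N\<close>. On them the expected number of hits of bin
\<open>k + 1\<close> at time \<open>n + 1\<close> is at most \<open>C * pmf \<mu> n\<close> times the expected content
of bin \<open>k\<close>. The induction carries the weight \<open>tail \<mu> n ^ (h - k)\<close>, one factor of which is
used up whenever two sums are exchanged.\<close>

lemma AE_bin_finite:
  assumes h: "1 \<le> h" and sm: "summable (\<lambda>n. tail \<mu> n ^ h)"
  shows "AE \<xi> in driving \<mu>. \<exists>m. \<forall>n. hits (fill h) \<xi> 0 n \<le> m"
proof -
  obtain C where C: "1 \<le> C"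
    and pf: "\<And>k n \<xi>. 1 \<le> k \<Longrightarrow> \<delta> * real n \<le> real (balls \<xi> n (Suc k)) \<Longrightarrow>
      comparable C (measure_pmf.prob \<mu> (fill (Suc k) n \<xi>)) (real (hits (fill k) \<xi> 0 n) * pmf \<mu> n)"
    using prob_fill_comparable by metis
  define good where "good N n \<xi> \<longleftrightarrow> (\<forall>m\<in>{N..n}. \<forall>k\<le>h. \<delta> * real m \<le> real (balls \<xi> m k))" for N n \<xi>
  have good_dep: "depends_on_first n (good N n)" for N n
    unfolding depends_on_first_def
  proof (intro allI impI)
    fix \<xi> \<xi>' :: "nat \<Rightarrow> nat" assume eq: "\<forall>i\<in>{1..n}. \<xi> i = \<xi>' i"
    have "balls \<xi> m k = balls \<xi>' m k" if "m \<le> n" for m k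
      using eq that by (intro depends_on_firstD[OF depends_on_first_balls]) auto
    then show "good N n \<xi> = good N n \<xi>'" by (auto simp: good_def)
  qed
  define b where "b N k n \<xi> = (of_bool (N \<le> n \<and> good N n \<xi> \<and> \<xi> (Suc n) \<in> fill k n \<xi>) :: ennreal)" for N k n \<xi>
  define a where "a N k n = (\<integral>\<^sup>+\<xi>. b N k n \<xi> \<partial>driving \<mu>)" for N k n
  have b_dep: "depends_on_first (Suc n) (b N k n)" for N k n
    unfolding depends_on_first_def
  proof (intro allI impI)
    fix \<xi> \<xi>' :: "nat \<Rightarrow> nat" assume eq: "\<forall>i\<in>{1..Suc n}. \<xi> i = \<xi>' i"
    have "good N n \<xi> = good N n \<xi>'" using eq by (intro depends_on_firstD[OF good_dep]) auto
    moreover have "fill k n \<xi> = fill k n \<xi>'" using eq by (intro depends_on_firstD[OF depends_on_first_fill]) auto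
    ultimately show "b N k n \<xi> = b N k n \<xi>'" using eq by (simp add: b_def)
  qed
  have b_meas [measurable]: "b N k n \<in> borel_measurable (driving \<mu>)" for N k n
    by (rule measurable_depends_on_first[OF b_dep]) simp
  have a_eq: "a N k n = (\<integral>\<^sup>+\<xi>. of_bool (N \<le> n \<and> good N n \<xi>) * ennreal (measure_pmf.prob \<mu> (fill k n \<xi>)) \<partial>driving \<mu>)" for N k n
  proof -
    define f where "f \<xi> x = (of_bool (N \<le> n \<and> good N n \<xi>) * indicator (fill k n \<xi>) x :: ennreal)" for \<xi> x
    have "depends_on_first n f"
      unfolding f_def fun_eq_iff by (rule depends_on_first_compose2[OF good_dep depends_on_first_fill])
    moreover have "b N k n \<xi> = f \<xi> (\<xi> (Suc n))" for \<xi> by (simp add: b_def f_def indicator_def)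
    then have b_eq: "b N k n = (\<lambda>\<xi>. f \<xi> (\<xi> (Suc n)))" by (rule ext)
    ultimately have "a N k n = (\<integral>\<^sup>+\<xi>. (\<integral>\<^sup>+x. f \<xi> x \<partial>measure_pmf \<mu>) \<partial>driving \<mu>)"
      unfolding a_def b_eq by (intro nn_integral_driving_next)
    then show ?thesis
      by (simp add: f_def nn_integral_cmult measure_pmf.emeasure_eq_measure)
  qed
  have a_1: "a N (Suc 0) n \<le> ennreal (tail \<mu> n)" for N n
  proof -
    have "a N (Suc 0) n \<le> (\<integral>\<^sup>+\<xi>. ennreal (tail \<mu> n) \<partial>driving \<mu>)"
      unfolding a_eq
    proof (intro nn_integral_mono)
      fix \<xi>
      have "ennreal (measure_pmf.prob \<mu> (fill (Suc 0) n \<xi>)) \<le> ennreal (tail \<mu> n)"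
        by (intro ennreal_leI) (simp add: prob_fill_1 tail_antimono)
      then show "of_bool (N \<le> n \<and> good N n \<xi>) * ennreal (measure_pmf.prob \<mu> (fill (Suc 0) n \<xi>)) \<le> ennreal (tail \<mu> n)"
        by (cases "N \<le> n \<and> good N n \<xi>") auto
    qed
    then show ?thesis by (simp add: driving.emeasure_space_1 del: One_nat_def)
  qed
  \<comment> \<open>At most \<open>N\<close> of the balls in bin \<open>k\<close> were placed before time \<open>N\<close>; the others were placed on the
    restricted event, which only shrinks as time goes on.\<close>
  have a_Suc: "a N (Suc k) n \<le> ennreal (C * pmf \<mu> n) * (of_nat N + (\<Sum>m. of_bool (m < n) * a N k m))"
    if k: "1 \<le> k" "Suc k \<le> h" for N k n
  proof -
    have "a N (Suc k) n \<le> (\<integral>\<^sup>+\<xi>. ennreal (C * pmf \<mu> n) * (of_nat N + (\<Sum>m. of_bool (m < n) * b N k m \<xi>)) \<partial>driving \<mu>)"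
      unfolding a_eq
    proof (intro nn_integral_mono)
      fix \<xi>
      show "of_bool (N \<le> n \<and> good N n \<xi>) * ennreal (measure_pmf.prob \<mu> (fill (Suc k) n \<xi>))
        \<le> ennreal (C * pmf \<mu> n) * (of_nat N + (\<Sum>m. of_bool (m < n) * b N k m \<xi>))"
      proof (cases "N \<le> n \<and> good N n \<xi>")
        case True
        then have "\<delta> * real n \<le> real (balls \<xi> n (Suc k))" using k by (auto simp: good_def)
        then have "measure_pmf.prob \<mu> (fill (Suc k) n \<xi>) \<le> C * (real (hits (fill k) \<xi> 0 n) * pmf \<mu> n)"
          using pf k by (auto simp: comparable_def)
        then have "ennreal (measure_pmf.prob \<mu> (fill (Suc k) n \<xi>)) \<le> ennreal (C * pmf \<mu> n * real (hits (fill k) \<xi> 0 n))"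
          by (intro ennreal_leI) (simp add: mult_ac)
        also have "\<dots> = ennreal (C * pmf \<mu> n) * of_nat (hits (fill k) \<xi> 0 n)"
          using C by (simp add: ennreal_mult ennreal_of_nat_eq_real_of_nat)
        also have "\<dots> \<le> ennreal (C * pmf \<mu> n) * (of_nat N + (\<Sum>m. of_bool (m < n) * b N k m \<xi>))"
        proof (intro mult_left_mono)
          have "(of_nat (hits (fill k) \<xi> 0 n) :: ennreal) \<le> of_nat (N + hits (fill k) \<xi> N n)"
            by (intro of_nat_mono hits_le_split)
          also have "\<dots> = of_nat N + (\<Sum>m=N..<n. of_bool (\<xi> (Suc m) \<in> fill k m \<xi>))"
            by (simp add: hits_def)
          also have "(\<Sum>m=N..<n. of_bool (\<xi> (Suc m) \<in> fill k m \<xi>)) = (\<Sum>m=N..<n. of_bool (m < n) * b N k m \<xi>)"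
            using True by (intro sum.cong) (auto simp: b_def good_def)
          also have "\<dots> \<le> (\<Sum>m. of_bool (m < n) * b N k m \<xi>)"
            by (intro sum_le_suminf) auto
          finally show "(of_nat (hits (fill k) \<xi> 0 n) :: ennreal) \<le> of_nat N + (\<Sum>m. of_bool (m < n) * b N k m \<xi>)"
            by (simp add: add_left_mono)
        qed simp
        finally show ?thesis using True by simp
      qed auto
    qed
    also have "\<dots> = ennreal (C * pmf \<mu> n) * (of_nat N + (\<Sum>m. of_bool (m < n) * a N k m))"
      by (simp add: nn_integral_cmult nn_integral_add nn_integral_suminf a_def driving.emeasure_space_1 del: One_nat_def)
    finally show ?thesis .
  qed
  have a_sum: "(\<Sum>n. a N k n * ennreal (tail \<mu> n ^ (h - k))) < \<infinity>" if k: "1 \<le> k" "k \<le> h" for N k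
    using k
  proof (induction k rule: dec_induct)
    case base
    have "(\<Sum>n. a N 1 n * ennreal (tail \<mu> n ^ (h - 1))) \<le> (\<Sum>n. ennreal (tail \<mu> n ^ h))"
    proof (intro suminf_le)
      fix n
      have "a N 1 n * ennreal (tail \<mu> n ^ (h - 1)) \<le> ennreal (tail \<mu> n) * ennreal (tail \<mu> n ^ (h - 1))"
        using a_1 by (intro mult_right_mono) auto
      also have "\<dots> = ennreal (tail \<mu> n ^ h)"
        using h by (cases h) (auto simp: ennreal_mult tail_nonneg)
      finally show "a N 1 n * ennreal (tail \<mu> n ^ (h - 1)) \<le> ennreal (tail \<mu> n ^ h)" .
    qed auto
    also have "\<dots> = ennreal (\<Sum>n. tail \<mu> n ^ h)" using sm by (intro suminf_ennreal2) (auto simp: tail_nonneg)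
    also have "\<dots> < \<infinity>" by simp
    finally show ?case .
  next
    case (step k)
    \<comment> \<open>The sum over \<open>n\<close> weighted by \<open>pmf \<mu> n\<close> is an expectation under \<open>\<mu>\<close>. It is taken inside the sum over
      \<open>m\<close>, where the constraint \<open>m < n\<close> contributes at most the probability \<open>tail \<mu> m\<close> of \<open>{m..}\<close>.\<close>
    define j where "j = h - Suc k"
    have hk: "h - k = Suc j" using step.prems by (simp add: j_def)
    let ?t = "\<lambda>n. ennreal (tail \<mu> n ^ j)"
    have t1: "?t n \<le> 1" for n by (simp add: power_le_one tail_nonneg tail_le_1)
    have "(\<Sum>n. a N (Suc k) n * ?t n) \<le> (\<Sum>n. ennreal C * (ennreal (pmf \<mu> n) * (of_nat N + (\<Sum>m. of_bool (m < n) * a N k m * ?t n))))"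
    proof (intro suminf_le)
      fix n
      have "a N (Suc k) n * ?t n \<le> ennreal (C * pmf \<mu> n) * (of_nat N + (\<Sum>m. of_bool (m < n) * a N k m)) * ?t n"
        using step by (intro mult_right_mono a_Suc) auto
      also have "\<dots> = ennreal C * (ennreal (pmf \<mu> n) * (of_nat N * ?t n + (\<Sum>m. of_bool (m < n) * a N k m * ?t n)))"
        unfolding ennreal_suminf_multc using C by (simp add: ennreal_mult distrib_right mult.assoc)
      also have "\<dots> \<le> ennreal C * (ennreal (pmf \<mu> n) * (of_nat N + (\<Sum>m. of_bool (m < n) * a N k m * ?t n)))"
        using mult_left_mono[OF t1[of n], of "of_nat N"] by (intro mult_left_mono add_right_mono) auto
      finally show "a N (Suc k) n * ?t n \<le> ennreal C * (ennreal (pmf \<mu> n) * (of_nat N + (\<Sum>m. of_bool (m < n) * a N k m * ?t n)))" .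
    qed auto
    also have "\<dots> = ennreal C * (\<Sum>n. ennreal (pmf \<mu> n) * (of_nat N + (\<Sum>m. of_bool (m < n) * a N k m * ?t n)))"
      by simp
    also have "(\<Sum>n. ennreal (pmf \<mu> n) * (of_nat N + (\<Sum>m. of_bool (m < n) * a N k m * ?t n))) =
        (\<integral>\<^sup>+n. (of_nat N + (\<Sum>m. of_bool (m < n) * a N k m * ?t n)) \<partial>measure_pmf \<mu>)"
      by (simp add: nn_integral_measure_pmf nn_integral_count_space_nat)
    also have "\<dots> = of_nat N + (\<Sum>m. \<integral>\<^sup>+n. of_bool (m < n) * a N k m * ?t n \<partial>measure_pmf \<mu>)"
      by (simp add: nn_integral_add nn_integral_suminf measure_pmf.emeasure_space_1[simplified]
          del: ennreal_suminf_multc)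
    also have "\<dots> \<le> of_nat N + (\<Sum>m. a N k m * ennreal (tail \<mu> m ^ (h - k)))"
    proof (intro add_left_mono suminf_le)
      fix m
      have "(\<integral>\<^sup>+n. of_bool (m < n) * a N k m * ?t n \<partial>measure_pmf \<mu>) \<le>
          (\<integral>\<^sup>+n. (a N k m * ?t m) * indicator {m..} n \<partial>measure_pmf \<mu>)"
      proof (intro nn_integral_mono)
        fix n
        have "?t n \<le> ?t m" if "m < n"
          using that by (intro ennreal_leI power_mono tail_antimono tail_nonneg) auto
        then show "of_bool (m < n) * a N k m * ?t n \<le> a N k m * ?t m * indicator {m..} n"
          by (auto simp: indicator_def intro: mult_left_mono)
      qed
      also have "\<dots> = a N k m * ?t m * emeasure (measure_pmf \<mu>) {m..}" by (simp add: nn_integral_cmult)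
      also have "\<dots> = a N k m * ennreal (tail \<mu> m ^ (h - k))"
        unfolding hk by (simp add: measure_pmf.emeasure_eq_measure tail_def[symmetric] ennreal_mult tail_nonneg mult_ac)
      finally show "(\<integral>\<^sup>+n. of_bool (m < n) * a N k m * ?t n \<partial>measure_pmf \<mu>) \<le> a N k m * ennreal (tail \<mu> m ^ (h - k))" .
    qed auto
    finally have "(\<Sum>n. a N (Suc k) n * ?t n) \<le> ennreal C * (of_nat N + (\<Sum>m. a N k m * ennreal (tail \<mu> m ^ (h - k))))"
      by (meson mult_left_mono order_trans zero_le)
    also have "\<dots> < \<infinity>"
      using step by (simp add: ennreal_mult_less_top ennreal_of_nat_eq_real_of_nat)
    finally show ?case by (simp add: j_def)
  qed
  have fin: "AE \<xi> in driving \<mu>. (\<Sum>n. b N h n \<xi>) \<noteq> \<infinity>" for N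
  proof (rule nn_integral_PInf_AE)
    have "(\<integral>\<^sup>+\<xi>. (\<Sum>n. b N h n \<xi>) \<partial>driving \<mu>) = (\<Sum>n. a N h n)"
      by (simp add: nn_integral_suminf a_def del: One_nat_def)
    then show "(\<integral>\<^sup>+\<xi>. (\<Sum>n. b N h n \<xi>) \<partial>driving \<mu>) \<noteq> \<infinity>" using a_sum[OF h order_refl, of N] by simp
  qed measurable
  have "AE \<xi> in driving \<mu>. \<forall>N. (\<Sum>n. b N h n \<xi>) \<noteq> \<infinity>"
    unfolding AE_all_countable using fin by blast
  with AE_balls_ge show ?thesis
  proof eventually_elim
    case (elim \<xi>)
    have "\<forall>\<^sub>F n in sequentially. \<forall>k\<in>{..h}. \<delta> * real n \<le> real (balls \<xi> n k)"
      using elim(1) by (intro eventually_ball_finite) auto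
    then obtain N where N: "\<And>n k. N \<le> n \<Longrightarrow> k \<le> h \<Longrightarrow> \<delta> * real n \<le> real (balls \<xi> n k)"
      unfolding eventually_sequentially by auto
    obtain B :: nat where B: "(\<Sum>n. b N h n \<xi>) < of_nat B"
      using elim(2) ennreal_Ex_less_of_nat by (auto simp: less_top)
    have "hits (fill h) \<xi> N n \<le> B" for n
    proof -
      have "of_nat (hits (fill h) \<xi> N n) \<le> (\<Sum>n. b N h n \<xi>)"
        unfolding b_def by (rule suminf_of_bool_ge_hits) (use N in \<open>auto simp: good_def\<close>)
      also note B
      finally show ?thesis by (simp only: of_nat_less_iff less_imp_le)
    qed
    then have "hits (fill h) \<xi> 0 n \<le> N + B" for n
      using hits_le_split[of "fill h" \<xi> n N] by (meson add_left_mono order_trans)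
    then show ?case by blast
  qed
qed

lemma AE_driving_pos: "AE \<xi> in driving \<mu>. \<forall>i\<ge>1. 1 \<le> \<xi> i"
proof -
  have "AE \<xi> in driving \<mu>. 1 \<le> \<xi> i" if i: "1 \<le> i" for i
  proof (rule AE_PiM_component)
    show "AE x in measure_pmf \<mu>. 1 \<le> x" using set_pmf_pos by (auto simp: AE_measure_pmf_iff)
  qed (use i in \<open>auto simp: measure_pmf.prob_space_axioms\<close>)
  then have "AE \<xi> in driving \<mu>. 1 \<le> i \<longrightarrow> 1 \<le> \<xi> i" for i by (cases "1 \<le> i") auto
  then show ?thesis unfolding AE_all_countable by blast
qed

lemma AE_bin_finite_iff:
  "AE \<xi> in driving \<mu>. \<forall>k\<ge>1. ibm_limit hat_config \<xi> (int k) < \<infinity> \<longleftrightarrow> summable (\<lambda>n. tail \<mu> n ^ k)"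
proof -
  have "AE \<xi> in driving \<mu>. 1 \<le> k \<longrightarrow> (ibm_limit hat_config \<xi> (int k) < \<infinity> \<longleftrightarrow> summable (\<lambda>n. tail \<mu> n ^ k))" for k
  proof (cases "1 \<le> k")
    case k: True
    show ?thesis
    proof (cases "summable (\<lambda>n. tail \<mu> n ^ k)")
      case s: True
      from AE_driving_pos AE_bin_finite[OF k s] show ?thesis
      proof eventually_elim
        case (elim \<xi>)
        show ?case unfolding ibm_limit_hat_finite_iff[OF elim(1) k] using elim(2) s by blast
      qed
    next
      case s: False
      from AE_driving_pos AE_bin_infinite[OF k s] show ?thesis
      proof eventually_elim
        case (elim \<xi>)
        show ?case unfolding ibm_limit_hat_finite_iff[OF elim(1) k] using elim(2) s by blast
      qed
    qed
  qed simp
  then show ?thesis unfolding AE_all_countable by (intro allI)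
qed

end

lemma summable_on_tail_power_iff:
  "(\<lambda>j. tail \<mu> j ^ h) summable_on {1..} \<longleftrightarrow> summable (\<lambda>n. tail \<mu> n ^ h)"
proof -
  have "(\<lambda>j. tail \<mu> j ^ h) summable_on {1..} \<longleftrightarrow> (\<lambda>j. tail \<mu> j ^ h) summable_on insert 0 {1..}"
    by (rule summable_on_insert_iff[symmetric])
  also have "insert 0 {1..} = (UNIV :: nat set)" by auto
  finally show ?thesis
    by (simp add: summable_on_UNIV_nonneg_real_iff tail_nonneg)
qed

theorem theorem1p7:
  fixes \<mu> :: "nat pmf" and \<alpha> :: real
  assumes "set_pmf \<mu> \<subseteq> {1..}"
    and "\<alpha> \<ge> 1"
    and "regularly_varying (pmf \<mu>) (- \<alpha>)"
  shows "(\<forall>d. has_type \<mu> d \<longleftrightarrow>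
             d = (INF h\<in>{h. 1 \<le> h \<and> (\<lambda>j. tail \<mu> j ^ h) summable_on {1..}}. enat h)) \<and>
         (\<alpha> > 1 \<longrightarrow> finite_type \<mu>) \<and>
         (\<alpha> = 1 \<longrightarrow> infinite_type \<mu>)"
proof -
  interpret regularly_varying_law \<mu> \<alpha> using assms by unfold_locales
  define H where "H = {h. 1 \<le> h \<and> (\<lambda>j. tail \<mu> j ^ h) summable_on {1..}}"
  define t where "t = (INF h\<in>H. enat h)"
  have front: "AE \<xi> in driving \<mu>. front \<xi> = t"
    using AE_bin_finite_iff
  proof eventually_elim
    case (elim \<xi>)
    then have "{k. 1 \<le> k \<and> ibm_limit hat_config \<xi> (int k) < \<infinity>} = H"
      unfolding H_def summable_on_tail_power_iff by blast
    then show ?case by (simp add: front_def t_def)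
  qed
  have type: "has_type \<mu> d \<longleftrightarrow> d = t" for d
  proof
    assume "has_type \<mu> d"
    then have "AE \<xi> in driving \<mu>. front \<xi> = d" by (simp only: has_type_def)
    with front have "AE \<xi> in driving \<mu>. d = t" by eventually_elim simp
    then show "d = t" by (simp add: driving.AE_const del: One_nat_def)
  qed (use front in \<open>simp only: has_type_def\<close>)
  have "t < \<infinity>" if "\<alpha> > 1"
  proof -
    obtain h where "1 \<le> h" "summable (\<lambda>n. tail \<mu> n ^ h)" using exists_summable_tail_power \<open>\<alpha> > 1\<close> by metis
    then have "h \<in> H" unfolding H_def summable_on_tail_power_iff by (intro CollectI conjI)
    then have "t \<le> enat h" unfolding t_def by (rule INF_lower)
    then show ?thesis by (rule le_less_trans) simp
  qed
  then have "\<alpha> > 1 \<longrightarrow> finite_type \<mu>"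
    using type by (auto simp: finite_type_def)
  moreover have "\<alpha> = 1 \<longrightarrow> infinite_type \<mu>"
  proof
    assume "\<alpha> = 1"
    have "h \<notin> H" for h
      using not_summable_g_power_index_1[OF \<open>\<alpha> = 1\<close>, of h] summable_tail_power_iff[of h]
      unfolding H_def summable_on_tail_power_iff mem_Collect_eq by argo
    then have "H = {}" by blast
    then have "t = \<infinity>" by (simp add: t_def top_enat_def)
    then show "infinite_type \<mu>" by (simp add: infinite_type_def type)
  qed
  moreover note type[unfolded t_def H_def]
  ultimately show ?thesis by (intro conjI allI)
qed

end
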